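(* For every admissible sequence $\alpha$, the elements $e_\alpha$ and $\tilde e_\alpha$ coincide in $D^4/\theta$, and the elements $f_{\alpha0}$ and $\tilde f_{\alpha0}$ coincide in $D^4/\theta$.
   Context: **Lattice.** $D^4$ is the free modular lattice generated by $e_1,e_2,e_3,e_4$, with a least element $0$ and a greatest element $I$ adjoined. Join is written $+$ (and $\sum$), meet is written as juxtaposition. **Linear equivalence $\theta$.** A representation of $D^4$ in a finite-dimensional vector space $V$ is a lattice homomorphism $\rho$ from $D^4$ to the lattice of subspaces of $V$ with $\rho(I)=V$, $\rho(0)=0$. $\theta$ is the congruence on $D^4$ identifying $a,b$ iff $\rho(a)=\rho(b)$ for every indecomposable finite-dimensional representation $\rho$ over any field. **Atomic elements.** For $\{i,j,k,l\}=\{1,2,3,4\}$: $a^{ij}_0=I$ and $a^{ij}_n=e_i+e_ja^{kl}_{n-1}$ for $n\ge1$ (here $e_ja^{kl}_{n-1}=e_ja^{lk}_{n-1}$). **Admissible sequences.** An admissible sequence is a nonempty finite sequence $\alpha=i_n\dots i_1$ with entries in $\{1,2,3,4\}$ and $i_p\ne i_{p+1}$; two are identified if one is obtained from the other by repeatedly replacing consecutive entries $ijl$ by $ikl$, where $\{i,j,k,l\}=\{1,2,3,4\}$. $i_1$ is the start, $i_n$ the end, $n$ the length. $(pq)^t$ denotes $pq$ repeated $t$ times. **Elements $e_\alpha$.** An admissible sequence starting at $1$ is, up to the identification, exactly one of the following, and $e_\alpha$ is defined accordingly ($r,s,t\ge0$ with the extra restriction listed): - $(21)^t(41)^r(31)^s$,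 $t\ge1$: $e_\alpha=e_2a^{31}_{2s}a^{41}_{2r}a^{34}_{2t-1}$; - $(31)^s(41)^r(21)^t$, $s\ge1$: $e_\alpha=e_3a^{21}_{2t}a^{41}_{2r}a^{24}_{2s-1}$; - $(41)^r(31)^s(21)^t$, $r\ge1$: $e_\alpha=e_4a^{21}_{2t}a^{31}_{2s}a^{32}_{2r-1}$; - $1(41)^r(31)^s(21)^t$: $e_\alpha=e_1a^{24}_{2s}a^{34}_{2t}a^{32}_{2r}$; - $2(41)^r(31)^s(21)^t$, $r\ge1$: $e_\alpha=e_2a^{34}_{2t}a^{31}_{2s+1}a^{14}_{2r-1}$; - $3(41)^r(21)^t(31)^s$, $r\ge1$: $e_\alpha=e_3a^{24}_{2s}a^{21}_{2t+1}a^{14}_{2r-1}$; - $4(21)^t(31)^s(41)^r$, $t\ge1$: $e_\alpha=e_4a^{32}_{2r}a^{31}_{2s+1}a^{12}_{2t-1}$; - $(14)^r(31)^s(21)^t$, $r,s\ge1$: $e_\alpha=e_1a^{23}_{2r-1}a^{24}_{2s-1}a^{34}_{2t+1}$. For a sequence starting at $m\ne1$, interchange the indices $1$ and $m$ everywhere. **Elements $f_{\alpha0}$.** For $\alpha=i$ of length 1, $f_{i0}=e_i(e_j+e_k+e_l)$, $\{i,j,k,l\}=\{1,2,3,4\}$. If $\alpha$ has length $\ge2$, write the expression defining $e_\alpha$ (a meet of one generator and three atomic elements) as $e_\alpha=e_ia^{jk}_ta^{kl}_sa^{lj}_r$ with $\{i,j,k,l\}=\{1,2,3,4\}$ labelled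 so that $r\ge1$ (the order of the two upper indices is irrelevant under meet with $e_i$); then $f_{\alpha0}=e_\alpha(e_ia^{jk}_{t+1}+a^{kl}_{s+1}a^{lj}_{r-1})$, which does not depend on the labelling chosen. **Gelfand–Ponomarev elements.** $\tilde e_i=e_i$; for $\alpha=i_n\dots i_1$ with $n\ge2$, $\tilde e_\alpha=e_{i_n}\sum_{\beta\in\Gamma_e(\alpha)}\tilde e_\beta$, where $\Gamma_e(\alpha)$ is the set of sequences $\beta=k_{n-1}\dots k_1$ in $\{1,2,3,4\}$ with $k_p\notin\{i_{p+1},i_p\}$ for $1\le p\le n-1$ and $k_p\ne k_{p+1}$. For $n\ge1$, $\tilde f_{\alpha0}=e_{i_n}\sum_{\beta\in\Gamma_f(\alpha)}\tilde e_\beta$, where $\Gamma_f(\alpha)$ is the set of sequences $\beta=k_n\dots k_1$ in $\{1,2,3,4\}$ with $k_1\ne i_1$, $k_p\notin\{i_p,i_{p-1}\}$ for $2\le p\le n$, and $k_p\ne k_{p+1}$. *)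

theory Defs
  imports Complex_Main "HOL-Library.Lattice_Constructions" "HOL-Combinatorics.Transposition"
begin

section \<open>The lattice \<open>D\<^sup>4\<close>\<close>

datatype idx = N1 | N2 | N3 | N4

lemma UNIV_idx: "UNIV = {N1, N2, N3, N4}"
  using idx.exhaust by blast

instance idx :: finite
  by standard (simp add: UNIV_idx)

datatype lterm = Gen idx | Join lterm lterm | Meet lterm lterm

text \<open>The least congruence containing the identities of modular lattices. The last identity is the
  modular law \<open>x \<le> z \<Longrightarrow> x + yz = (x + y)z\<close>, with \<open>xz\<close> in place of \<open>x\<close>.\<close>

inductive ml_eq :: "lterm \<Rightarrow> lterm \<Rightarrow> bool" where
  refl: "ml_eq x x"
| sym: "ml_eq x y \<Longrightarrow> ml_eq y x"
| trans: "ml_eq x y \<Longrightarrow> ml_eq y z \<Longrightarrow> ml_eq x z"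
| join_cong: "ml_eq x x' \<Longrightarrow> ml_eq y y' \<Longrightarrow> ml_eq (Join x y) (Join x' y')"
| meet_cong: "ml_eq x x' \<Longrightarrow> ml_eq y y' \<Longrightarrow> ml_eq (Meet x y) (Meet x' y')"
| join_comm: "ml_eq (Join x y) (Join y x)"
| meet_comm: "ml_eq (Meet x y) (Meet y x)"
| join_assoc: "ml_eq (Join (Join x y) z) (Join x (Join y z))"
| meet_assoc: "ml_eq (Meet (Meet x y) z) (Meet x (Meet y z))"
| join_absorb: "ml_eq (Join x (Meet x y)) x"
| meet_absorb: "ml_eq (Meet x (Join x y)) x"
| modular: "ml_eq (Join (Meet x z) (Meet y z)) (Meet (Join (Meet x z) y) z)"

quotient_type fm4 = lterm / ml_eq
  by (rule equivpI)
    (auto intro!: reflpI sympI transpI intro: ml_eq.refl ml_eq.sym ml_eq.trans)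

instantiation fm4 :: lattice
begin

lift_definition sup_fm4 :: "fm4 \<Rightarrow> fm4 \<Rightarrow> fm4" is Join
  by (rule ml_eq.join_cong)

lift_definition inf_fm4 :: "fm4 \<Rightarrow> fm4 \<Rightarrow> fm4" is Meet
  by (rule ml_eq.meet_cong)

definition less_eq_fm4 :: "fm4 \<Rightarrow> fm4 \<Rightarrow> bool" where
  "less_eq_fm4 x y \<longleftrightarrow> inf x y = x"

definition less_fm4 :: "fm4 \<Rightarrow> fm4 \<Rightarrow> bool" where
  "less_fm4 x y \<longleftrightarrow> x \<le> y \<and> x \<noteq> y"

instance
proof -
  have ic: "inf x y = inf y x" and sc: "sup x y = sup y x"
    and ia: "inf (inf x y) z = inf x (inf y z)" and sa: "sup (sup x y) z = sup x (sup y z)"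
    and si: "sup x (inf x y) = x" and ai: "inf x (sup x y) = x" for x y z :: fm4
    by (transfer, rule ml_eq.meet_comm ml_eq.join_comm ml_eq.meet_assoc ml_eq.join_assoc
        ml_eq.join_absorb ml_eq.meet_absorb)+
  have ii: "inf x x = x" for x :: fm4
    using ai[of x "inf x x"] si[of x x] by simp
  have le_sup: "x \<le> y \<longleftrightarrow> sup x y = y" for x y :: fm4
    unfolding less_eq_fm4_def using si[of y x] ai[of x y] ic[of x y] sc[of x y] by metis
  show "OFCLASS(fm4, lattice_class)"
  proof
    fix x y z :: fm4
    show antisym: "x \<le> y \<Longrightarrow> y \<le> x \<Longrightarrow> x = y"
      unfolding less_eq_fm4_def using ic[of x y] by simp
    show refl: "x \<le> x"
      unfolding less_eq_fm4_def by (rule ii)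
    show "x < y \<longleftrightarrow> x \<le> y \<and> \<not> y \<le> x"
      unfolding less_fm4_def using antisym refl by blast
    show "x \<le> y \<Longrightarrow> y \<le> z \<Longrightarrow> x \<le> z"
      unfolding less_eq_fm4_def using ia[of x y z] by simp
    show "inf x y \<le> x"
      unfolding less_eq_fm4_def using ia[of x x y] ic[of "inf x y" x] ii[of x] by simp
    show "inf x y \<le> y"
      unfolding less_eq_fm4_def using ia[of x y y] ii[of y] by simp
    show "x \<le> y \<Longrightarrow> x \<le> z \<Longrightarrow> x \<le> inf y z"
      unfolding less_eq_fm4_def using ia[of x y z] by simp
    show "x \<le> sup x y"
      unfolding less_eq_fm4_def by (rule ai)
    show "y \<le> sup x y"
      unfolding less_eq_fm4_def using ai[of y x] sc[of x y] by simp
    show "y \<le> x \<Longrightarrow> z \<le> x \<Longrightarrow> sup y z \<le> x"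
      unfolding le_sup using sa[of y z x] by simp
  qed
qed

end

instance top :: (bounded_lattice_bot) bounded_lattice
proof
  show "bot \<le> x" for x :: "'a top"
    by (cases x) (simp_all add: bot_top_def)
qed

text \<open>A new least element (\<^const>\<open>bot\<close>, the zero of \<open>D\<^sup>4\<close>) and a new greatest element
  (\<^const>\<open>top\<close>, the \<open>I\<close> of \<open>D\<^sup>4\<close>) are adjoined to the free modular lattice.\<close>

type_synonym d4 = "fm4 bot top"

lift_definition fm4_gen :: "idx \<Rightarrow> fm4" is Gen .

definition gen :: "idx \<Rightarrow> d4" where
  "gen i = top.Value (bot.Value (fm4_gen i))"


section \<open>Representations and linear equivalence\<close>

text \<open>The vector space is a finite-dimensional subspace \<open>V\<close> of an ambient space on the type \<open>'v\<close>.\<close>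

definition d4_representation ::
    "('k::field \<Rightarrow> 'v::ab_group_add \<Rightarrow> 'v) \<Rightarrow> 'v set \<Rightarrow> (d4 \<Rightarrow> 'v set) \<Rightarrow> bool" where
  "d4_representation scale V \<rho> \<longleftrightarrow>
     vector_space scale \<and>
     (\<exists>B. finite B \<and> V = module.span scale B) \<and>
     (\<forall>x. module.subspace scale (\<rho> x) \<and> \<rho> x \<subseteq> V) \<and>
     (\<forall>x y. \<rho> (sup x y) = {u + v | u v. u \<in> \<rho> x \<and> v \<in> \<rho> y}) \<and>
     (\<forall>x y. \<rho> (inf x y) = \<rho> x \<inter> \<rho> y) \<and>
     \<rho> top = V \<and> \<rho> bot = {0}"

definition d4_indecomposable ::
    "('k::field \<Rightarrow> 'v::ab_group_add \<Rightarrow> 'v) \<Rightarrow> 'v set \<Rightarrow> (d4 \<Rightarrow> 'v set) \<Rightarrow> bool" where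
  "d4_indecomposable scale V \<rho> \<longleftrightarrow>
     V \<noteq> {0} \<and>
     \<not> (\<exists>U W. module.subspace scale U \<and> module.subspace scale W \<and>
          U \<noteq> {0} \<and> W \<noteq> {0} \<and> U \<inter> W = {0} \<and> V = {u + w | u w. u \<in> U \<and> w \<in> W} \<and>
          (\<forall>x. \<rho> x = {u + w | u w. u \<in> \<rho> x \<inter> U \<and> w \<in> \<rho> x \<inter> W}))"

text \<open>A definition cannot quantify over types, so the field \<open>'k\<close> and the ambient space \<open>'v\<close> are type
  parameters. Linear equivalence is \<open>theta TYPE('k) TYPE('v)\<close> for all \<open>'k\<close> and \<open>'v\<close>.\<close>

definition theta :: "'k::field itself \<Rightarrow> 'v::ab_group_add itself \<Rightarrow> d4 \<Rightarrow> d4 \<Rightarrow> bool" where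
  "theta _ _ a b \<longleftrightarrow>
     (\<forall>(scale :: 'k \<Rightarrow> 'v \<Rightarrow> 'v) V \<rho>.
        d4_representation scale V \<rho> \<and> d4_indecomposable scale V \<rho> \<longrightarrow> \<rho> a = \<rho> b)"


section \<open>Atomic elements\<close>

text \<open>For \<open>i \<noteq> j\<close> the list \<open>rest i j\<close> consists of the two remaining indices. Their order is immaterial
  below, because \<open>e\<^sub>j a\<^sup>k\<^sup>l = e\<^sub>j a\<^sup>l\<^sup>k\<close>.\<close>

definition rest :: "idx \<Rightarrow> idx \<Rightarrow> idx list" where
  "rest i j = filter (\<lambda>k. k \<noteq> i \<and> k \<noteq> j) [N1, N2, N3, N4]"

fun atomic :: "idx \<Rightarrow> idx \<Rightarrow> nat \<Rightarrow> d4" where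
  "atomic i j 0 = top"
| "atomic i j (Suc n) = sup (gen i) (inf (gen j) (atomic (rest i j ! 0) (rest i j ! 1) n))"


section \<open>Admissible sequences\<close>

text \<open>The sequence \<open>i\<^sub>n \<dots> i\<^sub>1\<close> is the list \<open>[i\<^sub>n, \<dots>, i\<^sub>1]\<close>: its end is the head of the list and its
  start is the last entry.\<close>

definition admissible :: "idx list \<Rightarrow> bool" where
  "admissible \<alpha> \<longleftrightarrow> \<alpha> \<noteq> [] \<and> distinct_adj \<alpha>"

inductive move :: "idx list \<Rightarrow> idx list \<Rightarrow> bool" where
  "distinct [i, j, k, l] \<Longrightarrow> move (xs @ [i, j, l] @ ys) (xs @ [i, k, l] @ ys)"

text \<open>Moves are symmetric, so this is an equivalence relation.\<close>

definition seq_equiv :: "idx list \<Rightarrow> idx list \<Rightarrow> bool" where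
  "seq_equiv = move\<^sup>*\<^sup>*"

definition rpt :: "idx \<Rightarrow> idx \<Rightarrow> nat \<Rightarrow> idx list" where
  "rpt p q t = concat (replicate t [p, q])"


section \<open>The elements \<open>e\<^sub>\<alpha>\<close> and \<open>f\<^sub>\<alpha>\<^sub>0\<close>\<close>

text \<open>\<open>Expr i [(p, q, m), \<dots>]\<close> is the formal expression \<open>e\<^sub>i a\<^sup>p\<^sup>q\<^sub>m \<dots>\<close>. It is kept as syntax because
  \<open>f\<^sub>\<alpha>\<^sub>0\<close> depends on the indices occurring in the expression for \<open>e\<^sub>\<alpha>\<close>.\<close>

datatype 'i expr = Expr 'i "('i \<times> 'i \<times> nat) list"

fun expr_val :: "idx expr \<Rightarrow> d4" where
  "expr_val (Expr i fs) = foldl inf (gen i) (map (\<lambda>(p, q, m). atomic p q m) fs)"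

inductive canonical :: "idx list \<Rightarrow> idx expr \<Rightarrow> bool" where
  "t \<ge> 1 \<Longrightarrow> canonical (rpt N2 N1 t @ rpt N4 N1 r @ rpt N3 N1 s)
     (Expr N2 [(N3, N1, 2*s), (N4, N1, 2*r), (N3, N4, 2*t - 1)])"
| "s \<ge> 1 \<Longrightarrow> canonical (rpt N3 N1 s @ rpt N4 N1 r @ rpt N2 N1 t)
     (Expr N3 [(N2, N1, 2*t), (N4, N1, 2*r), (N2, N4, 2*s - 1)])"
| "r \<ge> 1 \<Longrightarrow> canonical (rpt N4 N1 r @ rpt N3 N1 s @ rpt N2 N1 t)
     (Expr N4 [(N2, N1, 2*t), (N3, N1, 2*s), (N3, N2, 2*r - 1)])"
| "canonical ([N1] @ rpt N4 N1 r @ rpt N3 N1 s @ rpt N2 N1 t)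
     (Expr N1 [(N2, N4, 2*s), (N3, N4, 2*t), (N3, N2, 2*r)])"
| "r \<ge> 1 \<Longrightarrow> canonical ([N2] @ rpt N4 N1 r @ rpt N3 N1 s @ rpt N2 N1 t)
     (Expr N2 [(N3, N4, 2*t), (N3, N1, 2*s + 1), (N1, N4, 2*r - 1)])"
| "r \<ge> 1 \<Longrightarrow> canonical ([N3] @ rpt N4 N1 r @ rpt N2 N1 t @ rpt N3 N1 s)
     (Expr N3 [(N2, N4, 2*s), (N2, N1, 2*t + 1), (N1, N4, 2*r - 1)])"
| "t \<ge> 1 \<Longrightarrow> canonical ([N4] @ rpt N2 N1 t @ rpt N3 N1 s @ rpt N4 N1 r)
     (Expr N4 [(N3, N2, 2*r), (N3, N1, 2*s + 1), (N1, N2, 2*t - 1)])"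
| "r \<ge> 1 \<Longrightarrow> s \<ge> 1 \<Longrightarrow> canonical (rpt N1 N4 r @ rpt N3 N1 s @ rpt N2 N1 t)
     (Expr N1 [(N2, N3, 2*r - 1), (N2, N4, 2*s - 1), (N3, N4, 2*t + 1)])"

text \<open>Interchanging the indices \<open>1\<close> and \<open>m\<close> carries the sequences starting at \<open>1\<close> to those starting
  at \<open>m\<close>.\<close>

definition seq_expr :: "idx list \<Rightarrow> idx expr" where
  "seq_expr \<alpha> = (THE E. \<exists>\<beta> F. canonical \<beta> F \<and>
     seq_equiv \<alpha> (map (transpose N1 (last \<alpha>)) \<beta>) \<and> E = map_expr (transpose N1 (last \<alpha>)) F)"

definition e_elt :: "idx list \<Rightarrow> d4" where
  "e_elt \<alpha> = expr_val (seq_expr \<alpha>)"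

text \<open>\<open>is_labelling E i j k l t s r\<close>: the expression \<open>E\<close> reads \<open>e\<^sub>i a\<^sup>j\<^sup>k\<^sub>t a\<^sup>k\<^sup>l\<^sub>s a\<^sup>l\<^sup>j\<^sub>r\<close> up to the order of
  the factors and the order of the two upper indices of each factor.\<close>

fun is_labelling ::
    "idx expr \<Rightarrow> idx \<Rightarrow> idx \<Rightarrow> idx \<Rightarrow> idx \<Rightarrow> nat \<Rightarrow> nat \<Rightarrow> nat \<Rightarrow> bool" where
  "is_labelling (Expr h fs) i j k l t s r \<longleftrightarrow>
     h = i \<and> distinct [i, j, k, l] \<and>
     (\<lambda>(p, q, m). ({p, q}, m)) ` set fs = {({j, k}, t), ({k, l}, s), ({l, j}, r)}"

text \<open>\<open>SOME\<close> picks one of the admitted labellings. The value does not depend on the choice.\<close>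

definition f0_elt :: "idx list \<Rightarrow> d4" where
  "f0_elt \<alpha> =
     (if length \<alpha> = 1
      then inf (gen (hd \<alpha>)) (Sup_fin (gen ` (- {hd \<alpha>})))
      else SOME x. \<exists>i j k l t s r. is_labelling (seq_expr \<alpha>) i j k l t s r \<and> r \<ge> 1 \<and>
             x = inf (e_elt \<alpha>)
                   (sup (inf (gen i) (atomic j k (t + 1))) (inf (atomic k l (s + 1)) (atomic l j (r - 1)))))"


section \<open>Gelfand--Ponomarev elements\<close>

text \<open>In terms of list positions, \<open>\<beta> ! q\<close> is \<open>k\<^sub>p\<close> for \<open>p = length \<beta> - q\<close>. Thus the pair
  \<open>\<alpha> ! q, \<alpha> ! Suc q\<close> is \<open>i\<^sub>p\<^sub>+\<^sub>1, i\<^sub>p\<close> in the first set and \<open>i\<^sub>p, i\<^sub>p\<^sub>-\<^sub>1\<close> in the second.\<close>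

definition Gamma_e :: "idx list \<Rightarrow> idx list set" where
  "Gamma_e \<alpha> = {\<beta>. Suc (length \<beta>) = length \<alpha> \<and>
     (\<forall>q < length \<beta>. \<beta> ! q \<notin> {\<alpha> ! q, \<alpha> ! Suc q}) \<and> distinct_adj \<beta>}"

definition Gamma_f :: "idx list \<Rightarrow> idx list set" where
  "Gamma_f \<alpha> = {\<beta>. length \<beta> = length \<alpha> \<and> last \<beta> \<noteq> last \<alpha> \<and>
     (\<forall>q. Suc q < length \<beta> \<longrightarrow> \<beta> ! q \<notin> {\<alpha> ! q, \<alpha> ! Suc q}) \<and> distinct_adj \<beta>}"

text \<open>For admissible \<open>\<alpha>\<close> (of length at least \<open>2\<close> in the first case) both sets are finite and nonempty,
  as \<^const>\<open>Sup_fin\<close> requires.\<close>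

function e_tilde :: "idx list \<Rightarrow> d4" where
  "e_tilde \<alpha> =
     (if length \<alpha> \<le> 1 then gen (hd \<alpha>) else inf (gen (hd \<alpha>)) (Sup_fin (e_tilde ` Gamma_e \<alpha>)))"
  by pat_completeness auto
termination
  by (relation "measure length") (auto simp: Gamma_e_def)

declare e_tilde.simps [simp del]

definition f0_tilde :: "idx list \<Rightarrow> d4" where
  "f0_tilde \<alpha> = inf (gen (hd \<alpha>)) (Sup_fin (e_tilde ` Gamma_f \<alpha>))"

end

theory Submission
  imports Defs "HOL-Library.Function_Algebras" "HOL-Library.Multiset" "HOL-Library.Set_Algebras"
begin

text \<open>The pairing of two indices \<open>i \<noteq> j\<close> is the partition of the four indices into \<open>i, j\<close> and the other two;
  there are three pairings. The steps of a sequence are the pairings of its neighbouring entries. Replacing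
  \<open>ijl\<close> by \<open>ikl\<close> interchanges two neighbouring steps. Hence a sequence is determined up to equivalence by its
  start and its multiset of steps (\<open>seq_equiv_if_steps_eq\<close>), and the eight families of expressions are
  the eight parity patterns of the three multiplicities. Consequently \<open>e\<^sub>\<alpha>\<close> is \<open>E\<^sub>i(N)\<close>, the meet of \<open>e\<^sub>i\<close> with
  the elements \<open>a\<^sup>p\<^sup>q\<^sub>n\<close>, where \<open>i\<close> is the end of \<open>\<alpha>\<close>, \<open>N\<close> its multiset of steps, \<open>p, q\<close> are two other indices
  and \<open>n\<close> is the multiplicity in \<open>N\<close> of the pairing of \<open>p\<close> and \<open>q\<close>. If \<open>N = M + R\<close> for a pairing \<open>R\<close>, and \<open>S, T\<close> are
  the other two pairings, then \<open>f\<^sub>\<alpha>\<^sub>0\<close> has the value of \<open>E\<^sub>i(M + R)(E\<^sub>i(M + T) + E\<^sub>i(M + S))\<close> in every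
  representation.

  The Gelfand--Ponomarev elements lie below. Let \<open>\<beta>\<close> run through \<open>\<Gamma>(\<alpha>)\<close>, and read \<open>\<alpha>\<close> and \<open>\<beta>\<close> in parallel
  from their ends. The pairing of the current entries and the next step of \<open>\<alpha>\<close> are, in some order, the next
  step of \<open>\<beta>\<close> and the pairing of the next entries. So \<open>\<beta>\<close> has the steps of \<open>\<alpha>\<close> up to one pairing at either
  end (\<open>steps_Gamma_e\<close>, \<open>steps_Gamma_f\<close>). It follows that each \<open>e\<^sub>\<beta>\<close>, and by induction
  each Gelfand--Ponomarev element of \<open>\<beta>\<close>, lies below every atomic factor of \<open>e\<^sub>\<alpha>\<close>
  (\<open>E_subset_atomic\<close>) and, when \<open>\<alpha>\<close> has length at least 2, below the second factor of \<open>f\<^sub>\<alpha>\<^sub>0\<close>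
  (\<open>f0_tilde_subset\<close>).

  They lie above by reflection. A quadruple \<open>X\<close> of subgroups is reflected to the quadruple \<open>X\<^sup>+\<close> in the group
  of all \<open>v = (v\<^sub>1, \<dots>, v\<^sub>4)\<close> with \<open>v\<^sub>i \<in> X\<^sub>i\<close> and \<open>\<Sum> v\<^sub>i = 0\<close>, where \<open>X\<^sup>+\<^sub>m\<close> is given by \<open>v\<^sub>m = 0\<close>. A vector
  \<open>v\<close> lies in the value of \<open>a\<^sup>p\<^sup>q\<^sub>n\<close> at \<open>X\<^sup>+\<close> iff \<open>v\<^sub>p\<close> lies in the value of \<open>a\<^sup>r\<^sup>s\<^sub>n\<close> at \<open>X\<close>
  (\<open>R_atomic\<close>). Therefore the elements of \<open>e\<^sub>h\<^sub>\<alpha>\<close> and \<open>f\<^sub>h\<^sub>\<alpha>\<^sub>0\<close> at \<open>X\<close> lift along \<open>v \<mapsto> v\<^sub>h\<close> to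
  elements of \<open>e\<^sub>\<alpha>\<close> and \<open>f\<^sub>\<alpha>\<^sub>0\<close> at \<open>X\<^sup>+\<close> (\<open>lift_E\<close>, \<open>lift_F\<close>, where \<open>R\<close> has to be a step
  of \<open>\<alpha>\<close>; if \<open>\<alpha>\<close> has any step, this can be arranged by \<open>F_relabel\<close>). In the other direction, \<open>v\<^sub>i = 0\<close> gives
  \<open>v\<^sub>h = - (v\<^sub>k + v\<^sub>l)\<close>, and so \<open>v \<mapsto> v\<^sub>h\<close> carries the Gelfand--Ponomarev elements of \<open>\<alpha>\<close> at \<open>X\<^sup>+\<close> into those
  of \<open>h\<alpha>\<close> at \<open>X\<close> (\<open>coord_e_tilde\<close>, \<open>coord_f0_tilde\<close>). Induction on the length of \<open>\<alpha>\<close> for all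
  quadruples at once concludes the proof.\<close>


section \<open>Representations by subgroups\<close>

definition add_subgroup :: "'w::ab_group_add set \<Rightarrow> bool" where
  "add_subgroup A \<longleftrightarrow> 0 \<in> A \<and> (\<forall>x\<in>A. \<forall>y\<in>A. x - y \<in> A)"

lemma add_subgroup_zero: "add_subgroup A \<Longrightarrow> 0 \<in> A"
  and add_subgroup_diff: "add_subgroup A \<Longrightarrow> x \<in> A \<Longrightarrow> y \<in> A \<Longrightarrow> x - y \<in> A"
  by (auto simp: add_subgroup_def)

lemma add_subgroup_minus: "add_subgroup A \<Longrightarrow> x \<in> A \<Longrightarrow> - x \<in> A"
  using add_subgroup_diff[of A 0 x] add_subgroup_zero[of A] by simp

lemma add_subgroup_add: "add_subgroup A \<Longrightarrow> x \<in> A \<Longrightarrow> y \<in> A \<Longrightarrow> x + y \<in> A"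
  using add_subgroup_diff[of A x "- y"] add_subgroup_minus[of A y] by simp

lemma add_subgroup_Int: "add_subgroup A \<Longrightarrow> add_subgroup B \<Longrightarrow> add_subgroup (A \<inter> B)"
  by (auto simp: add_subgroup_def)

lemma set_plus_eq: "A + B = {u + v | u v. u \<in> A \<and> v \<in> B}"
  by (auto simp: set_plus_def)

lemma add_subgroup_sum:
  assumes "add_subgroup A" "add_subgroup B"
  shows "add_subgroup {u + v | u v. u \<in> A \<and> v \<in> B}"
  unfolding add_subgroup_def
proof (intro conjI ballI)
  have "0 + 0 \<in> {u + v | u v. u \<in> A \<and> v \<in> B}"
    using assms add_subgroup_zero by blast
  then show "0 \<in> {u + v | u v. u \<in> A \<and> v \<in> B}"
    by (simp only: add_0_left)
  fix x y assume "x \<in> {u + v | u v. u \<in> A \<and> v \<in> B}" "y \<in> {u + v | u v. u \<in> A \<and> v \<in> B}"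
  then obtain a b c d where "x = a + b" "y = c + d" "a \<in> A" "c \<in> A" "b \<in> B" "d \<in> B" by blast
  then have "x - y = (a - c) + (b - d)" "a - c \<in> A" "b - d \<in> B"
    using assms by (simp_all add: add_subgroup_diff)
  then show "x - y \<in> {u + v | u v. u \<in> A \<and> v \<in> B}" by blast
qed

text \<open>Sums and intersections of subspaces refer to the additive group only, so subgroups take the place of
  subspaces.\<close>

locale subgroup_rep =
  fixes \<rho> :: "d4 \<Rightarrow> 'w::ab_group_add set"
  assumes subgroup: "add_subgroup (\<rho> a)"
    and sup: "\<rho> (sup a b) = {u + v | u v. u \<in> \<rho> a \<and> v \<in> \<rho> b}"
    and inf: "\<rho> (inf a b) = \<rho> a \<inter> \<rho> b"
begin

abbreviation X :: "idx \<Rightarrow> 'w set" where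
  "X i \<equiv> \<rho> (gen i)"

abbreviation A :: "idx \<Rightarrow> idx \<Rightarrow> nat \<Rightarrow> 'w set" where
  "A i j n \<equiv> \<rho> (atomic i j n)"

lemmas zero = add_subgroup_zero[OF subgroup]
  and add = add_subgroup_add[OF subgroup]
  and diff = add_subgroup_diff[OF subgroup]
  and minus = add_subgroup_minus[OF subgroup]

lemma mono: "a \<le> b \<Longrightarrow> \<rho> a \<subseteq> \<rho> b"
proof -
  assume "a \<le> b"
  then have "\<rho> a \<inter> \<rho> b = \<rho> a" using inf[of a b] by (simp add: inf_absorb1)
  then show ?thesis by blast
qed

lemma Sup_fin_upper: "finite S \<Longrightarrow> a \<in> S \<Longrightarrow> \<rho> a \<subseteq> \<rho> (Sup_fin S)"
  by (rule mono) (rule Sup_fin.coboundedI)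

lemma Sup_fin_least:
  assumes "finite S" "S \<noteq> {}" "add_subgroup B" "\<And>a. a \<in> S \<Longrightarrow> \<rho> a \<subseteq> B"
  shows "\<rho> (Sup_fin S) \<subseteq> B"
  using assms(1,2,4)
proof (induction rule: finite_ne_induct)
  case (insert a S)
  then have "\<rho> a \<subseteq> B" "\<rho> (Sup_fin S) \<subseteq> B" by blast+
  moreover have "\<rho> (Sup_fin (insert a S)) = {u + v | u v. u \<in> \<rho> a \<and> v \<in> \<rho> (Sup_fin S)}"
    using insert.hyps by (simp add: sup)
  ultimately show ?case using add_subgroup_add[OF assms(3)] by (simp add: subset_iff) blast
qed simp

section \<open>Atomic elements in a representation\<close>

lemma rest_cases:
  assumes "distinct [p, q, r, s]"
  shows "rest p q = [r, s] \<or> rest p q = [s, r]"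
  using assms by (cases p; cases q; cases r; cases s) (simp_all add: rest_def)

lemma rest_commute: "rest p q = rest q p"
  unfolding rest_def by (rule filter_cong) auto

lemma atomic_zero: "X i \<subseteq> A p q 0"
  by (simp add: mono)

lemma atomic_fst: "X p \<subseteq> A p q n"
  by (cases n) (simp_all add: mono)

text \<open>The identity \<open>e\<^sub>ia\<^sup>p\<^sup>q\<^sub>n = e\<^sub>ia\<^sup>q\<^sup>p\<^sub>n\<close>. Write \<open>x \<in> X\<^sub>i\<close> as \<open>u + w\<close> with \<open>u \<in> X\<^sub>p\<close> and
  \<open>w \<in> X\<^sub>q a\<^sup>r\<^sup>s\<^sub>n\<close>. Here \<open>i\<close> is one of \<open>r, s\<close>, and by induction \<open>w\<close> lies in the variant of \<open>a\<^sup>r\<^sup>s\<^sub>n\<close> that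
  has \<open>i\<close> as first index. This variant contains \<open>X\<^sub>i\<close>, hence also \<open>u = x - w\<close>, so that \<open>u\<close> and \<open>w\<close> can be
  exchanged.\<close>

lemma atomic_flip:
  assumes "distinct [i, p, q]" "x \<in> X i" "x \<in> A p q n"
  shows "x \<in> A q p n"
  using assms
proof (induction n arbitrary: i p q x)
  case 0
  then show ?case by simp
next
  case (Suc n)
  define r s where "r = rest p q ! 0" and "s = rest p q ! 1"
  have rs: "distinct [p, q, r, s]" "i = r \<or> i = s"
    using Suc.prems(1) unfolding r_def s_def
    by (cases i; cases p; cases q; simp add: rest_def)+
  obtain u w where uw: "u \<in> X p" "w \<in> X q" "w \<in> A r s n" "x = u + w"
    using Suc.prems(3) by (auto simp: sup inf r_def s_def)
  define j where "j = (if i = r then s else r)"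
  have ij: "(i = r \<and> j = s) \<or> (i = s \<and> j = r)" using rs by (auto simp: j_def)
  have "w \<in> A i j n" using ij uw Suc.IH[of q r s w] rs by auto
  moreover have "x \<in> A i j n" using Suc.prems(2) atomic_fst by auto
  moreover have "u = x - w" using uw by simp
  ultimately have "u \<in> A i j n" using diff by blast
  then have "u \<in> A r s n" using ij uw Suc.IH[of p i j u] rs by auto
  moreover have "x = w + u" using uw by (simp add: add.commute)
  ultimately show ?case
    using uw unfolding atomic.simps sup inf rest_commute[of q p] r_def s_def by blast
qed

text \<open>By \<open>atomic_flip\<close> the order that \<^const>\<open>rest\<close> chooses for the two remaining indices can be
  forgotten.\<close>

lemma atomic_SucE:
  assumes "x \<in> A p q (Suc n)" "distinct [p, q, r, s]"
  obtains u w where "u \<in> X p" "w \<in> X q" "w \<in> A r s n" "x = u + w"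
proof -
  obtain u w where "u \<in> X p" "w \<in> X q" "w \<in> A (rest p q ! 0) (rest p q ! 1) n" "x = u + w"
    using assms(1) by (auto simp: sup inf)
  moreover from this have "w \<in> A r s n"
    using rest_cases[OF assms(2)] atomic_flip[of q s r w n] assms(2) by auto
  ultimately show thesis using that by blast
qed

lemma atomic_SucI:
  assumes "u \<in> X p" "w \<in> X q" "w \<in> A r s n" "distinct [p, q, r, s]"
  shows "u + w \<in> A p q (Suc n)"
proof -
  have "w \<in> A (rest p q ! 0) (rest p q ! 1) n"
    using rest_cases[OF assms(4)] atomic_flip[of q r s w n] assms by auto
  then show ?thesis using assms by (auto simp: sup inf)
qed

lemma atomic_snd_Suc:
  assumes "w \<in> X q" "w \<in> A r s n" "distinct [p, q, r, s]"
  shows "w \<in> A p q (Suc n)"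
  using atomic_SucI[of 0 p w q r s n] assms zero by simp

lemma atomic_Suc_subset: "p \<noteq> q \<Longrightarrow> A p q (Suc n) \<subseteq> A p q n"
proof (induction n arbitrary: p q)
  case 0
  then show ?case by (simp add: mono)
next
  case (Suc n)
  have "rest p q ! 0 \<noteq> rest p q ! 1"
    using Suc.prems by (cases p; cases q) (simp_all add: rest_def)
  from Suc.IH[OF this] show ?case
    unfolding atomic.simps(2)[of p q "Suc n"] atomic.simps(2)[of p q n] sup inf by blast
qed

lemma atomic_antimono: "p \<noteq> q \<Longrightarrow> m \<le> n \<Longrightarrow> A p q n \<subseteq> A p q m"
  using lift_Suc_antimono_le[of "A p q" m n] atomic_Suc_subset by blast

end

section \<open>Pairings of the four indices and steps of a sequence\<close>

definition pairing :: "idx \<Rightarrow> idx \<Rightarrow> idx set set" where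
  "pairing i j = {{i, j}, - {i, j}}"

lemma UNIV_eq_distinct: "distinct [i, j, k, l] \<Longrightarrow> (UNIV :: idx set) = {i, j, k, l}"
  using UNIV_idx by (cases i; cases j; cases k; cases l) auto

lemma ex_new_idx:
  obtains m :: idx where "m \<noteq> i" "m \<noteq> j" "m \<noteq> k"
proof -
  have "card {i, j, k} \<le> 3" by (simp add: card_insert_if)
  moreover have "card (UNIV :: idx set) = 4" by (simp add: UNIV_idx)
  ultimately have "{i, j, k} \<noteq> UNIV" by auto
  then show thesis using that by auto
qed

lemma ex_distinct4:
  assumes "distinct [i, j, k]"
  obtains l :: idx where "distinct [i, j, k, l]"
proof -
  obtain l where "l \<noteq> i" "l \<noteq> j" "l \<noteq> k" by (rule ex_new_idx)
  then show thesis using assms that[of l] by auto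
qed

lemma ex_distinct34:
  assumes "i \<noteq> j"
  obtains k l :: idx where "distinct [i, j, k, l]"
proof -
  obtain k where "k \<noteq> i" "k \<noteq> j" using ex_new_idx[of i j j] by blast
  then have "distinct [i, j, k]" using assms by auto
  then obtain l where "distinct [i, j, k, l]" by (rule ex_distinct4)
  then show thesis by (rule that)
qed

lemma pairing_commute: "pairing i j = pairing j i"
  by (simp add: pairing_def insert_commute)

lemma pairing_complement: "distinct [i, j, k, l] \<Longrightarrow> pairing i j = pairing k l"
proof -
  assume d: "distinct [i, j, k, l]"
  then have "- {i, j} = {k, l}" "- {k, l} = {i, j}"
    using UNIV_eq_distinct[OF d] by auto
  then show ?thesis by (auto simp: pairing_def)
qed

lemma pairing_eq_iff: "i \<noteq> j \<Longrightarrow> i \<noteq> k \<Longrightarrow> pairing i j = pairing i k \<longleftrightarrow> j = k"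
  by (auto simp: pairing_def doubleton_eq_iff)

lemma pairing_cases:
  assumes "distinct [i, j, k, l]" "p \<noteq> q"
  shows "pairing p q = pairing i j \<or> pairing p q = pairing i k \<or> pairing p q = pairing i l"
proof -
  have "p \<in> {i, j, k, l}" "q \<in> {i, j, k, l}" using UNIV_eq_distinct[OF assms(1)] by auto
  moreover have "pairing k l = pairing i j" "pairing j l = pairing i k" "pairing j k = pairing i l"
    using assms(1) by (auto intro!: pairing_complement)
  ultimately show ?thesis
    using assms(2) by (auto simp: pairing_commute)
qed

fun steps :: "idx list \<Rightarrow> idx set set multiset" where
  "steps (i # j # xs) = add_mset (pairing i j) (steps (j # xs))"
| "steps _ = {#}"

section \<open>The Gelfand--Ponomarev index sets\<close>

lemma Gamma_e_single [simp]: "Gamma_e [i] = {[]}"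
  by (auto simp: Gamma_e_def)

lemma Gamma_e_Cons:
  "k # \<gamma> \<in> Gamma_e (h # i # \<alpha>) \<longleftrightarrow>
     k \<noteq> h \<and> k \<noteq> i \<and> \<gamma> \<in> Gamma_e (i # \<alpha>) \<and> (\<gamma> \<noteq> [] \<longrightarrow> k \<noteq> hd \<gamma>)"
  by (cases \<gamma>) (auto simp: Gamma_e_def All_less_Suc2)

lemma Gamma_f_single: "\<beta> \<in> Gamma_f [i] \<longleftrightarrow> (\<exists>k. k \<noteq> i \<and> \<beta> = [k])"
  by (auto simp: Gamma_f_def length_Suc_conv)

lemma Gamma_f_Cons:
  "k # \<gamma> \<in> Gamma_f (h # i # \<alpha>) \<longleftrightarrow>
     k \<noteq> h \<and> k \<noteq> i \<and> \<gamma> \<in> Gamma_f (i # \<alpha>) \<and> k \<noteq> hd \<gamma>"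
  by (cases \<gamma>) (auto simp: Gamma_f_def All_less_Suc2)

lemma finite_lists_length_idx: "finite {\<beta> :: idx list. length \<beta> = n}"
  using finite_lists_length_eq[of "UNIV :: idx set" n] by simp

lemma finite_Gamma_e [simp]: "finite (Gamma_e \<alpha>)"
  by (rule finite_subset[OF _ finite_lists_length_idx[of "length \<alpha> - 1"]]) (auto simp: Gamma_e_def)

lemma finite_Gamma_f [simp]: "finite (Gamma_f \<alpha>)"
  by (rule finite_subset[OF _ finite_lists_length_idx[of "length \<alpha>"]]) (auto simp: Gamma_f_def)

text \<open>Since there are four indices, a sequence can be prolonged while avoiding three of them.\<close>

lemma Gamma_e_nonempty: "\<alpha> \<noteq> [] \<Longrightarrow> Gamma_e \<alpha> \<noteq> {}"
proof (induction \<alpha> rule: induct_list012)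
  case (3 h i \<alpha>)
  then obtain \<gamma> where \<gamma>: "\<gamma> \<in> Gamma_e (i # \<alpha>)" by auto
  obtain k where "k \<noteq> h" "k \<noteq> i" "k \<noteq> hd \<gamma>" by (rule ex_new_idx)
  with \<gamma> have "k # \<gamma> \<in> Gamma_e (h # i # \<alpha>)" by (simp add: Gamma_e_Cons)
  then show ?case by blast
qed simp_all

lemma Gamma_f_nonempty: "\<alpha> \<noteq> [] \<Longrightarrow> Gamma_f \<alpha> \<noteq> {}"
proof (induction \<alpha> rule: induct_list012)
  case (2 i)
  obtain k where "k \<noteq> i" "k \<noteq> i" "k \<noteq> i" by (rule ex_new_idx)
  then show ?case using Gamma_f_single[of "[k]" i] by blast
next
  case (3 h i \<alpha>)
  then obtain \<gamma> where \<gamma>: "\<gamma> \<in> Gamma_f (i # \<alpha>)" by auto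
  obtain k where "k \<noteq> h" "k \<noteq> i" "k \<noteq> hd \<gamma>" by (rule ex_new_idx)
  with \<gamma> have "k # \<gamma> \<in> Gamma_f (h # i # \<alpha>)" by (simp add: Gamma_f_Cons)
  then show ?case by blast
qed simp

lemma Gamma_e_D:
  assumes "\<beta> \<in> Gamma_e \<alpha>" "length \<alpha> \<ge> 2"
  shows "\<beta> \<noteq> []" "distinct_adj \<beta>" "length \<beta> < length \<alpha>" "hd \<beta> \<noteq> hd \<alpha>"
proof -
  obtain h i \<alpha>' where \<alpha>: "\<alpha> = h # i # \<alpha>'" using assms(2) by (cases \<alpha>; cases "tl \<alpha>") auto
  obtain k \<gamma> where \<beta>: "\<beta> = k # \<gamma>" using assms(1) by (cases \<beta>) (auto simp: \<alpha> Gamma_e_def)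
  show "hd \<beta> \<noteq> hd \<alpha>" using assms(1) by (simp add: \<alpha> \<beta> Gamma_e_Cons)
  show "\<beta> \<noteq> []" by (simp add: \<beta>)
  show "distinct_adj \<beta>" "length \<beta> < length \<alpha>" using assms(1) by (simp_all add: Gamma_e_def)
qed

lemma Gamma_f_D:
  assumes "\<beta> \<in> Gamma_f \<alpha>" "\<alpha> \<noteq> []"
  shows "\<beta> \<noteq> []" "distinct_adj \<beta>" "hd \<beta> \<noteq> hd \<alpha>"
proof -
  show b: "\<beta> \<noteq> []" "distinct_adj \<beta>" using assms by (auto simp: Gamma_f_def)
  obtain h \<alpha>' where \<alpha>: "\<alpha> = h # \<alpha>'" using assms(2) by (cases \<alpha>) auto
  obtain k \<gamma> where \<beta>: "\<beta> = k # \<gamma>" using b by (cases \<beta>) auto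
  show "hd \<beta> \<noteq> hd \<alpha>"
    using assms(1) by (cases \<alpha>') (auto simp: \<alpha> \<beta> Gamma_f_single Gamma_f_Cons)
qed

text \<open>The exchange behind the parallel run along \<open>\<alpha>\<close> and \<open>\<beta>\<close>: \<open>m\<close> is either \<open>h\<close> or the fourth index, and in
  both cases the two sides agree term by term up to order.\<close>

lemma pairing_exchange:
  assumes "h \<noteq> i" "k \<noteq> h" "k \<noteq> i" "m \<noteq> i" "m \<noteq> k"
  shows "{#pairing h i, pairing h k#} = {#pairing i m, pairing k m#}"
proof (cases "m = h")
  case True
  then show ?thesis using pairing_commute by simp
next
  case False
  then have "distinct [h, i, k, m]" "distinct [h, k, i, m]" using assms by auto
  from this[THEN pairing_complement] show ?thesis by (simp add: add_mset_commute)
qed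

text \<open>Repeated exchange moves the pairing of the heads of \<open>\<alpha>\<close> and \<open>\<beta>\<close> through to the pairing of their
  starts.\<close>

lemma steps_Gamma_f:
  assumes "\<beta> \<in> Gamma_f \<alpha>" "\<alpha> \<noteq> []" "distinct_adj \<alpha>"
  shows "\<exists>p q. p \<noteq> q \<and>
    add_mset (pairing (hd \<alpha>) (hd \<beta>)) (steps \<alpha>) = add_mset (pairing p q) (steps \<beta>)"
  using assms
proof (induction \<alpha> arbitrary: \<beta> rule: induct_list012)
  case (2 i)
  then obtain k where "k \<noteq> i" "\<beta> = [k]" by (auto simp: Gamma_f_single)
  then have "i \<noteq> k \<and> add_mset (pairing (hd [i]) (hd \<beta>)) (steps [i]) = add_mset (pairing i k) (steps \<beta>)"
    by simp
  then show ?case by blast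
next
  case (3 h i \<alpha>)
  then have "\<beta> \<noteq> []" by (auto simp: Gamma_f_def)
  then obtain k \<gamma> where \<beta>: "\<beta> = k # \<gamma>" by (cases \<beta>) auto
  with 3 have k: "k \<noteq> h" "k \<noteq> i" "\<gamma> \<in> Gamma_f (i # \<alpha>)" "k \<noteq> hd \<gamma>" and hi: "h \<noteq> i"
    by (auto simp: Gamma_f_Cons)
  then have "\<gamma> \<noteq> []" by (auto simp: Gamma_f_def)
  then obtain m \<delta> where \<gamma>: "\<gamma> = m # \<delta>" by (cases \<gamma>) auto
  have "m \<noteq> i"
    using k(3) unfolding \<gamma> by (cases \<alpha>) (auto simp: Gamma_f_single Gamma_f_Cons)
  then have ex: "{#pairing h i, pairing h k#} = {#pairing i m, pairing k m#}"
    using k hi \<gamma> by (intro pairing_exchange) auto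
  obtain p q where "p \<noteq> q"
    and IH: "add_mset (pairing i m) (steps (i # \<alpha>)) = add_mset (pairing p q) (steps \<gamma>)"
    using 3(2)[OF k(3)] 3(5) \<gamma> by auto
  have "add_mset (pairing h k) (steps (h # i # \<alpha>)) = {#pairing h i, pairing h k#} + steps (i # \<alpha>)"
    by simp
  also have "\<dots> = add_mset (pairing k m) (add_mset (pairing i m) (steps (i # \<alpha>)))"
    unfolding ex by simp
  also have "\<dots> = add_mset (pairing p q) (steps \<beta>)"
    unfolding IH by (simp add: \<beta> \<gamma> add_mset_commute)
  finally have "add_mset (pairing h k) (steps (h # i # \<alpha>)) = add_mset (pairing p q) (steps \<beta>)" .
  then show ?case using \<beta> \<open>p \<noteq> q\<close> by auto
qed simp

text \<open>Here \<open>\<beta>\<close> is shorter by one entry, so the first step \<open>P\<close> of \<open>\<alpha>\<close> is left over together with the pairing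
  \<open>Q\<close> that faces it. They differ because the first entry of \<open>\<beta>\<close> differs from the first two of \<open>\<alpha>\<close>.\<close>

lemma steps_Gamma_e:
  assumes "\<beta> \<in> Gamma_e \<alpha>" "length \<alpha> \<ge> 2" "distinct_adj \<alpha>"
  shows "\<exists>P Q. P \<noteq> Q \<and>
    add_mset (pairing (hd \<alpha>) (hd \<beta>)) (steps \<alpha>) = add_mset P (add_mset Q (steps \<beta>))"
  using assms
proof (induction \<alpha> arbitrary: \<beta> rule: induct_list012)
  case (3 h i \<alpha>)
  then have "\<beta> \<noteq> []" by (auto simp: Gamma_e_def)
  then obtain k \<gamma> where \<beta>: "\<beta> = k # \<gamma>" by (cases \<beta>) auto
  with 3 have k: "k \<noteq> h" "k \<noteq> i" "\<gamma> \<in> Gamma_e (i # \<alpha>)" "\<gamma> \<noteq> [] \<longrightarrow> k \<noteq> hd \<gamma>" and hi: "h \<noteq> i"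
    by (auto simp: Gamma_e_Cons)
  show ?case
  proof (cases "\<alpha> = []")
    case True
    then show ?thesis using k hi \<beta> pairing_eq_iff[of h i k] by auto
  next
    case False
    then have "\<gamma> \<noteq> []" using k(3) by (auto simp: Gamma_e_def)
    then obtain m \<delta> where \<gamma>: "\<gamma> = m # \<delta>" by (cases \<gamma>) auto
    have "m \<noteq> i" using k(3) False unfolding \<gamma> by (cases \<alpha>) (auto simp: Gamma_e_Cons)
    then have ex: "{#pairing h i, pairing h k#} = {#pairing i m, pairing k m#}"
      using k hi \<gamma> by (intro pairing_exchange) auto
    obtain P Q where "P \<noteq> Q"
      and IH: "add_mset (pairing i m) (steps (i # \<alpha>)) = add_mset P (add_mset Q (steps \<gamma>))"
      using 3(2)[OF k(3)] 3(5) False \<gamma> by (cases \<alpha>) auto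
    have "add_mset (pairing h k) (steps (h # i # \<alpha>)) = {#pairing h i, pairing h k#} + steps (i # \<alpha>)"
      by simp
    also have "\<dots> = add_mset (pairing k m) (add_mset (pairing i m) (steps (i # \<alpha>)))"
      unfolding ex by simp
    also have "\<dots> = add_mset P (add_mset Q (steps \<beta>))"
      unfolding IH by (simp add: \<beta> \<gamma> add_mset_commute)
    finally have "add_mset (pairing h k) (steps (h # i # \<alpha>)) = add_mset P (add_mset Q (steps \<beta>))" .
    then show ?thesis using \<beta> \<open>P \<noteq> Q\<close> by auto
  qed
qed simp_all

section \<open>Meets of a generator with atomic elements\<close>

declare atomic.simps(2) [simp del]

context subgroup_rep
begin

text \<open>The general form of \<open>e\<^sub>\<alpha>\<close>. Both orders of \<open>p, q\<close> occur because \<open>a\<^sup>p\<^sup>q\<close> and \<open>a\<^sup>q\<^sup>p\<close> agree only below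
  \<open>e\<^sub>i\<close>; by \<open>E_I\<close> it suffices to check one of them.\<close>

definition E :: "idx \<Rightarrow> idx set set multiset \<Rightarrow> 'w set" where
  "E i M = {x \<in> X i. \<forall>p q. distinct [i, p, q] \<longrightarrow> x \<in> A p q (count M (pairing p q))}"

lemma E_gen: "x \<in> E i M \<Longrightarrow> x \<in> X i"
  by (simp add: E_def)

lemma E_atomic:
  "x \<in> E i M \<Longrightarrow> distinct [i, p, q] \<Longrightarrow> n \<le> count M (pairing p q) \<Longrightarrow> x \<in> A p q n"
  by (rule subsetD[OF atomic_antimono[of p q n "count M (pairing p q)"]]) (simp_all add: E_def)

lemma E_I:
  assumes "distinct [i, p, q, r]" "x \<in> X i"
    and "x \<in> A p q (count M (pairing p q))"
    and "x \<in> A p r (count M (pairing p r))"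
    and "x \<in> A q r (count M (pairing q r))"
  shows "x \<in> E i M"
  unfolding E_def
proof (intro CollectI conjI allI impI)
  fix p' q' assume d: "distinct [i, p', q']"
  have "p' \<in> {i, p, q, r}" "q' \<in> {i, p, q, r}" using UNIV_eq_distinct[OF assms(1)] by auto
  with d consider "p' = p" "q' = q" | "p' = q" "q' = p" | "p' = p" "q' = r" | "p' = r" "q' = p"
    | "p' = q" "q' = r" | "p' = r" "q' = q" by auto
  then show "x \<in> A p' q' (count M (pairing p' q'))"
  proof cases
    case 2
    then show ?thesis using assms atomic_flip[of i p q x] by (simp add: pairing_commute)
  next
    case 4
    then show ?thesis using assms atomic_flip[of i p r x] by (simp add: pairing_commute)
  next
    case 6
    then show ?thesis using assms atomic_flip[of i q r x] by (simp add: pairing_commute)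
  qed (use assms in auto)
qed (rule assms)

lemma subgroup_E: "add_subgroup (E i M)"
  unfolding add_subgroup_def by (auto simp: E_def zero diff)

lemmas E_add = add_subgroup_add[OF subgroup_E]
  and E_diff = add_subgroup_diff[OF subgroup_E]

lemma E_antimono: "M \<subseteq># N \<Longrightarrow> E i N \<subseteq> E i M"
proof
  fix x assume "M \<subseteq># N" "x \<in> E i N"
  then show "x \<in> E i M"
    using E_gen[of x i N] E_atomic[of x i N] unfolding E_def subseteq_mset_def by blast
qed

lemma E_empty: "E i {#} = X i"
  using atomic_zero by (auto simp: E_def)

section \<open>Upper bounds for the Gelfand--Ponomarev elements\<close>

text \<open>If \<open>k = p\<close>, then \<open>e\<^sub>k \<le> a\<^sup>p\<^sup>q\<^sub>n\<close>. If \<open>k = q\<close>, then \<open>e\<^sub>ka\<^sup>r\<^sup>i\<^sub>n\<^sub>-\<^sub>1 \<le> a\<^sup>p\<^sup>q\<^sub>n\<close>, so that one step of \<open>M\<close> may be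
  missing. Otherwise \<open>a\<^sup>p\<^sup>q\<close> is a factor of \<open>E\<^sub>k(M)\<close> itself, and no step is lost; this is the case in which the pairings
  of \<open>p, q\<close> and \<open>i, k\<close> coincide.\<close>

lemma E_subset_atomic:
  assumes "distinct [i, p, q]" "k \<noteq> i"
    and n: "n + (if pairing p q = pairing i k then 1 else 0) \<le> count M (pairing p q) + 1"
  shows "E k M \<subseteq> A p q n"
proof
  fix x assume x: "x \<in> E k M"
  have xk: "x \<in> X k" using x by (rule E_gen)
  consider "k = p" | "k = q" | "distinct [i, k, p, q]" using assms by auto
  then show "x \<in> A p q n"
  proof cases
    case 1
    then show ?thesis using xk atomic_fst by blast
  next
    case 2
    obtain r where r: "distinct [i, p, q, r]" using ex_distinct4[OF assms(1)] .
    show ?thesis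
    proof (cases n)
      case 0
      then show ?thesis using xk atomic_zero by blast
    next
      case (Suc m)
      have "pairing p q = pairing r i"
        using r by (intro pairing_complement) auto
      then have "x \<in> A r i m"
        using 2 r n Suc by (intro E_atomic[OF x]) (auto simp: pairing_commute split: if_splits)
      then have "x \<in> A p q (Suc m)"
        using xk 2 r by (intro atomic_snd_Suc[of x q r i m p]) auto
      then show ?thesis using Suc by simp
    qed
  next
    case 3
    then have "pairing i k = pairing p q" by (rule pairing_complement)
    then show ?thesis using 3 n by (intro E_atomic[OF x]) auto
  qed
qed

lemma e_tilde_subset_E:
  "\<alpha> \<noteq> [] \<Longrightarrow> distinct_adj \<alpha> \<Longrightarrow> \<rho> (e_tilde \<alpha>) \<subseteq> E (hd \<alpha>) (steps \<alpha>)"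
proof (induction \<alpha> rule: measure_induct_rule[where f = length])
  case (less \<alpha>)
  show ?case
  proof (cases "length \<alpha> \<ge> 2")
    case False
    then obtain i where "\<alpha> = [i]" using less.prems by (cases \<alpha>; cases "tl \<alpha>") auto
    then show ?thesis by (simp add: e_tilde.simps[of "[i]"] E_empty)
  next
    case True
    have "\<rho> (e_tilde \<beta>) \<subseteq> A p q (count (steps \<alpha>) (pairing p q))"
      if \<beta>: "\<beta> \<in> Gamma_e \<alpha>" and pq: "distinct [hd \<alpha>, p, q]" for \<beta> p q
    proof -
      have b: "\<beta> \<noteq> []" "distinct_adj \<beta>" "length \<beta> < length \<alpha>" "hd \<beta> \<noteq> hd \<alpha>"
        using Gamma_e_D[OF \<beta> True] by auto
      then have "\<rho> (e_tilde \<beta>) \<subseteq> E (hd \<beta>) (steps \<beta>)" by (intro less.IH)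
      also obtain P Q where PQ: "P \<noteq> Q"
        "add_mset (pairing (hd \<alpha>) (hd \<beta>)) (steps \<alpha>) = add_mset P (add_mset Q (steps \<beta>))"
        using steps_Gamma_e[OF \<beta> True less.prems(2)] by blast
      have "count (steps \<alpha>) (pairing p q) + (if pairing p q = pairing (hd \<alpha>) (hd \<beta>) then 1 else 0)
          \<le> count (steps \<beta>) (pairing p q) + 1"
        using arg_cong[OF PQ(2), of "\<lambda>M. count M (pairing p q)"] PQ(1) by (auto split: if_splits)
      then have "E (hd \<beta>) (steps \<beta>) \<subseteq> A p q (count (steps \<alpha>) (pairing p q))"
        using pq b by (intro E_subset_atomic) auto
      finally show ?thesis .
    qed
    then have "\<rho> (Sup_fin (e_tilde ` Gamma_e \<alpha>)) \<subseteq> A p q (count (steps \<alpha>) (pairing p q))"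
      if "distinct [hd \<alpha>, p, q]" for p q
      using that Gamma_e_nonempty[OF less.prems(1)] subgroup by (intro Sup_fin_least) auto
    then show ?thesis
      using True by (subst e_tilde.simps) (auto simp: inf E_def)
  qed
qed

text \<open>By \<open>steps_Gamma_f\<close>, every \<open>\<beta> \<in> \<Gamma>(\<alpha>)\<close> has the steps of \<open>\<alpha>\<close> together with the pairing of the heads and
  without one pairing \<open>D\<close>. Therefore \<open>E_subset_atomic\<close> still applies to \<open>\<beta>\<close> after any one pairing \<open>\<noteq> D\<close> has been
  added to the steps of \<open>\<alpha>\<close>. If \<open>D \<noteq> S\<close>, where \<open>S\<close> is the pairing of \<open>k\<close> and \<open>l\<close>, this puts \<open>e\<^sub>\<beta>\<close> below
  \<open>a\<^sup>k\<^sup>l\<^sub>s\<^sub>+\<^sub>1a\<^sup>l\<^sup>j\<^sub>r\<^sub>-\<^sub>1\<close>. If \<open>D = S\<close>, an element of \<open>e\<^sub>\<beta>\<close> has to be split as \<open>k' + i'\<close> along \<open>a\<^sup>k\<^sup>i\<close>.\<close>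

lemma f0_tilde_subset:
  assumes "\<alpha> \<noteq> []" "distinct_adj \<alpha>" and d: "distinct [hd \<alpha>, j, k, l]"
    and r: "count (steps \<alpha>) (pairing l j) \<ge> 1"
  shows "\<rho> (f0_tilde \<alpha>) \<subseteq> E (hd \<alpha>) (steps \<alpha>) \<inter>
    \<rho> (sup (inf (gen (hd \<alpha>)) (atomic j k (count (steps \<alpha>) (pairing j k) + 1)))
         (inf (atomic k l (count (steps \<alpha>) (pairing k l) + 1))
              (atomic l j (count (steps \<alpha>) (pairing l j) - 1))))"
proof -
  define i where "i = hd \<alpha>"
  define N where "N = steps \<alpha>"
  define t s r where "t = count N (pairing j k)" and "s = count N (pairing k l)"
    and "r = count N (pairing l j)"
  \<comment> \<open>the second factor of \<open>f\<^sub>\<alpha>\<^sub>0\<close>\<close>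
  define W where "W = \<rho> (sup (inf (gen i) (atomic j k (t + 1))) (inf (atomic k l (s + 1)) (atomic l j (r - 1))))"
  have W: "W = {u + v | u v. (u \<in> X i \<and> u \<in> A j k (t + 1)) \<and> v \<in> A k l (s + 1) \<and> v \<in> A l j (r - 1)}"
    by (simp add: W_def sup inf)
  have d: "distinct [i, j, k, l]" using d by (simp add: i_def)
  have ne: "pairing j k \<noteq> pairing k l" "pairing l j \<noteq> pairing k l"
    using d pairing_eq_iff[of k j l] pairing_eq_iff[of l j k] by (auto simp: pairing_commute)
  have "r \<ge> 1" using r by (simp add: r_def N_def)
  have bound: "\<rho> (e_tilde \<beta>) \<subseteq> W \<and> (\<forall>p q. distinct [i, p, q] \<longrightarrow> \<rho> (e_tilde \<beta>) \<subseteq> A p q (count N (pairing p q)))"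
    if \<beta>: "\<beta> \<in> Gamma_f \<alpha>" for \<beta>
  proof -
    define m where "m = hd \<beta>"
    have b: "\<beta> \<noteq> []" "distinct_adj \<beta>" and mi: "m \<noteq> i"
      using Gamma_f_D[OF \<beta> assms(1)] by (simp_all add: m_def i_def)
    have sub: "\<rho> (e_tilde \<beta>) \<subseteq> E m (steps \<beta>)" unfolding m_def using b by (rule e_tilde_subset_E)
    obtain p0 q0 where "p0 \<noteq> q0"
      and "add_mset (pairing i m) N = add_mset (pairing p0 q0) (steps \<beta>)"
      using steps_Gamma_f[OF \<beta> assms(1,2)] unfolding i_def m_def N_def by blast
    then obtain D where eq: "add_mset (pairing i m) N = add_mset D (steps \<beta>)" by blast
    \<comment> \<open>one additional step \<open>Q \<noteq> D\<close> is affordable\<close>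
    have up: "E m (steps \<beta>) \<subseteq> A p q (count (add_mset Q N) (pairing p q))"
      if "distinct [i, p, q]" "Q \<noteq> D" for p q Q
      using that mi arg_cong[OF eq, of "\<lambda>M. count M (pairing p q)"]
      by (intro E_subset_atomic) (auto split: if_splits)
    have up0: "E m (steps \<beta>) \<subseteq> A p q (count N (pairing p q))" if "distinct [i, p, q]" for p q
      using that mi arg_cong[OF eq, of "\<lambda>M. count M (pairing p q)"]
      by (intro E_subset_atomic) (auto split: if_splits)
    have "x \<in> W" if x: "x \<in> E m (steps \<beta>)" for x
    proof (cases "D = pairing k l")
      case False
      then have "x \<in> A k l (s + 1)"
        using up[of k l "pairing k l"] x d by (auto simp: s_def)
      moreover have "x \<in> A l j (r - 1)"
        using up0[of l j] x d atomic_antimono[of l j "r - 1" r] by (auto simp: r_def)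
      ultimately have "0 + x \<in> W" unfolding W using zero by blast
      then show ?thesis by simp
    next
      case True
      have xt: "x \<in> A k j (t + 1)"
        using up[of k j "pairing j k"] x d True ne by (auto simp: t_def pairing_commute)
      have xr: "x \<in> A l j (r - 1)"
        using up0[of l j] x d atomic_antimono[of l j "r - 1" r] by (auto simp: r_def)
      \<comment> \<open>for \<open>m = k\<close> the splitting is trivial, otherwise the factor \<open>a\<^sup>k\<^sup>i\<close> of \<open>e\<^sub>\<beta>\<close> provides it\<close>
      have "\<exists>i' k'. i' \<in> X i \<and> i' \<in> A j l (r - 1) \<and> k' \<in> X k \<and> x = k' + i'"
      proof (cases "m = k")
        case True
        then show ?thesis using E_gen[OF x] zero by (metis add.right_neutral)
      next
        case False
        have pki: "pairing k i = pairing l j" using d by (intro pairing_complement) auto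
        then have "pairing i m \<noteq> pairing l j"
          using False mi d pairing_eq_iff[of i m k] by (auto simp: pairing_commute)
        then have "r \<le> count (steps \<beta>) (pairing k i)"
          using arg_cong[OF eq, of "\<lambda>M. count M (pairing l j)"] True ne pki by (auto simp: r_def split: if_splits)
        then have "x \<in> A k i (Suc (r - 1))"
          using E_atomic[OF x, of k i] False mi d \<open>r \<ge> 1\<close> by auto
        then show ?thesis using d by (elim atomic_SucE[of _ _ _ _ j l]) auto
      qed
      then obtain i' k' where ik: "i' \<in> X i" "i' \<in> A j l (r - 1)" "k' \<in> X k" "x = k' + i'" by blast
      have "i' = x - k'" "k' = x - i'" using ik by simp_all
      have "i' \<in> A k j (t + 1)"
        unfolding \<open>i' = x - k'\<close> using xt ik(3) atomic_fst by (intro diff) auto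
      then have "i' \<in> A j k (t + 1)" using d ik(1) by (intro atomic_flip[of i k j]) auto
      moreover have "i' \<in> A l j (r - 1)" using ik d by (intro atomic_flip[of i j l]) auto
      then have "k' \<in> A l j (r - 1)" unfolding \<open>k' = x - i'\<close> using xr by (intro diff) auto
      moreover have "k' \<in> A k l (s + 1)" using ik(3) atomic_fst by blast
      ultimately have "i' + k' \<in> W" unfolding W using ik(1) by blast
      then show ?thesis using ik(4) by (simp add: add.commute)
    qed
    then show ?thesis using sub up0 by blast
  qed
  have least: "\<rho> (Sup_fin (e_tilde ` Gamma_f \<alpha>)) \<subseteq> B"
    if "add_subgroup B" "\<And>\<beta>. \<beta> \<in> Gamma_f \<alpha> \<Longrightarrow> \<rho> (e_tilde \<beta>) \<subseteq> B" for B
    using that Gamma_f_nonempty[OF assms(1)] by (intro Sup_fin_least) auto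
  have "\<rho> (Sup_fin (e_tilde ` Gamma_f \<alpha>)) \<subseteq> W"
    using bound by (intro least) (simp_all add: W_def subgroup)
  moreover have "\<rho> (Sup_fin (e_tilde ` Gamma_f \<alpha>)) \<subseteq> A p q (count N (pairing p q))"
    if "distinct [i, p, q]" for p q
    using bound that by (intro least subgroup) blast
  ultimately show ?thesis
    unfolding f0_tilde_def W_def t_def s_def r_def i_def N_def inf E_def by blast
qed

end

context subgroup_rep
begin

section \<open>The elements \<open>f\<^sub>\<alpha>\<^sub>0\<close> in terms of multisets of steps\<close>

text \<open>For \<open>R, S, T\<close> the three pairings, this is the form of \<open>f\<^sub>\<alpha>\<^sub>0\<close> at a sequence ending in \<open>i\<close> whose steps are
  \<open>M\<close> and \<open>R\<close>. It is symmetric in \<open>S\<close> and \<open>T\<close>.\<close>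

definition F :: "idx \<Rightarrow> idx set set multiset \<Rightarrow> idx set set \<Rightarrow> idx set set \<Rightarrow> idx set set \<Rightarrow> 'w set" where
  "F i M R S T = E i (add_mset R M) \<inter> (E i (add_mset T M) + E i (add_mset S M))"

lemma F_swap: "F i M R S T = F i M R T S"
  by (simp add: F_def add.commute)

text \<open>The form does not depend on which step of the sequence is singled out. Given \<open>x = y + z\<close> as on the
  left hand side, decompose \<open>y = q\<^sub>1 + w\<^sub>1\<close> along \<open>a\<^sup>q\<^sup>w\<close> and then \<open>w\<^sub>1 = p\<^sub>1 + h\<^sub>1\<close> along \<open>a\<^sup>p\<^sup>h\<close>; moving \<open>h\<^sub>1\<close> from
  \<open>y\<close> to \<open>z\<close> gives the decomposition \<open>x = (q\<^sub>1 + p\<^sub>1) + (x - q\<^sub>1 - p\<^sub>1)\<close> for the right hand side.\<close>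

lemma F_relabel:
  assumes d: "distinct [h, p, q, w]"
    and R: "R = pairing p q" and S: "S = pairing p w" and T: "T = pairing q w"
  shows "F h (add_mset T M) R S T \<subseteq> F h (add_mset R M) T S R"
proof
  fix x assume "x \<in> F h (add_mset T M) R S T"
  then obtain y z where xE: "x \<in> E h (add_mset R (add_mset T M))" and x: "x = y + z"
    and y: "y \<in> E h (add_mset T (add_mset T M))" and z: "z \<in> E h (add_mset S (add_mset T M))"
    by (auto simp: F_def set_plus_eq)
  have d': "distinct [w, q, p, h]" using d by auto
  define r s t where "r = count M R" and "s = count M S" and "t = count M T"
  have ne: "R \<noteq> S" "R \<noteq> T" "S \<noteq> T" "S \<noteq> R" "T \<noteq> R" "T \<noteq> S"
    using d pairing_eq_iff[of p q w] pairing_eq_iff[of q p w] pairing_eq_iff[of w p q]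
    by (auto simp: R S T pairing_commute)
  have Xh: "x \<in> X h" "y \<in> X h" "z \<in> X h" using xE y z E_gen by blast+
  have yA: "y \<in> A q w (Suc (Suc t))" "y \<in> A p q r" "y \<in> A p w s"
    by (intro E_atomic[OF y]; use d d' ne in \<open>simp add: r_def s_def t_def flip: R S T\<close>)+
  have zA: "z \<in> A q w t" "z \<in> A p w (Suc s)"
    by (intro E_atomic[OF z]; use d d' ne in \<open>simp add: r_def s_def t_def flip: R S T\<close>)+
  have xA: "x \<in> A p q (Suc r)"
    by (intro E_atomic[OF xE]; use d d' ne in \<open>simp add: r_def s_def t_def flip: R S T\<close>)+
  have dhp: "distinct [q, w, p, h]" "distinct [p, h, q, w]" using d by auto
  obtain q1 w1 where q1: "q1 \<in> X q" and w1: "w1 \<in> X w" "w1 \<in> A p h (Suc t)" and y1: "y = q1 + w1"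
    using atomic_SucE[OF yA(1) dhp(1)] .
  obtain p1 h1 where p1: "p1 \<in> X p" and h1: "h1 \<in> X h" "h1 \<in> A q w t" and w2: "w1 = p1 + h1"
    using atomic_SucE[OF w1(2) dhp(2)] .
  have eqs: "w1 = y - q1" "q1 = y - w1" "h1 = w1 - p1" "p1 = w1 - h1"
    "y - h1 = q1 + p1" "z + h1 = x - q1 - p1" "x = (y - h1) + (z + h1)"
    by (simp_all add: x y1 w2)
  have "y \<in> A q h (Suc s)" "y \<in> A w h (Suc r)"
    using d Xh yA by (auto intro!: atomic_snd_Suc[of y h p w s q] atomic_snd_Suc[of y h p q r w])
  then have "y - q1 \<in> A q h (Suc s)" "y - w1 \<in> A w h (Suc r)"
    using diff subsetD[OF atomic_fst q1] subsetD[OF atomic_fst w1(1)] by blast+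
  then have w1s: "w1 \<in> A h q (Suc s)" and q1r: "q1 \<in> A h w (Suc r)"
    using d q1 w1 atomic_flip[of w q h w1 "Suc s"] atomic_flip[of q w h q1 "Suc r"]
    unfolding eqs(1,2)[symmetric] by auto
  have w1s': "w1 \<in> A h q s" using w1s atomic_antimono[of h q s "Suc s"] d by auto
  have q1r': "q1 \<in> A p q (Suc (Suc r))"
    using d q1 q1r by (auto intro!: atomic_snd_Suc[of q1 q h w "Suc r" p])
  have "w1 \<in> A p w (Suc s)"
    using d w1 w1s' by (auto intro!: atomic_snd_Suc[of w1 w h q s p])
  then have h1s: "h1 \<in> A p w (Suc s)"
    unfolding eqs(3) using diff subsetD[OF atomic_fst p1] by blast
  have "y - h1 \<in> A q w t"
    using yA(1) h1 atomic_antimono[of q w t "Suc (Suc t)"] d by (intro diff) auto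
  moreover have "y - h1 \<in> A p w s"
    using yA(3) h1s atomic_antimono[of p w s "Suc s"] d by (intro diff) auto
  moreover have "y - h1 \<in> A p q (Suc (Suc r))"
    unfolding eqs(5) using add[OF q1r' subsetD[OF atomic_fst p1]] .
  ultimately have yE: "y - h1 \<in> E h (add_mset R (add_mset R M))"
    using d d' ne Xh h1 by (intro E_I[of h p q w])
      (simp_all add: r_def s_def t_def diff flip: R S T)
  have "q1 \<in> A p q (Suc r)" using q1r' atomic_antimono[of p q "Suc r" "Suc (Suc r)"] d by auto
  then have "z + h1 \<in> A p q (Suc r)"
    unfolding eqs(6) using diff[OF diff[OF xA] subsetD[OF atomic_fst p1]] by blast
  moreover have "z + h1 \<in> A q w t" "z + h1 \<in> A p w (Suc s)"
    using zA h1 h1s by (simp_all add: add)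
  ultimately have zE: "z + h1 \<in> E h (add_mset S (add_mset R M))"
    using d d' ne Xh h1 by (intro E_I[of h p q w])
      (simp_all add: r_def s_def t_def add flip: R S T)
  have "x \<in> E h (add_mset T (add_mset R M))" using xE by (simp add: add_mset_commute)
  then show "x \<in> F h (add_mset R M) T S R"
    unfolding F_def set_plus_eq using eqs(7) yE zE by blast
qed

text \<open>Modular law: if \<open>x = y + z\<close> lies in \<open>E\<^sub>i(N)\<close> with \<open>y\<close> in the first and \<open>z\<close> in the second summand, then \<open>z = x - y\<close>
  lies in every factor that contains \<open>x\<close> and \<open>y\<close>, and likewise for \<open>y = x - z\<close>.\<close>

lemma f_formula_subset_F:
  assumes d: "distinct [i, j, k, l]" and N: "N = add_mset (pairing l j) M"
  shows "E i N \<inter> \<rho> (sup (inf (gen i) (atomic j k (count N (pairing j k) + 1)))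
         (inf (atomic k l (count N (pairing k l) + 1)) (atomic l j (count N (pairing l j) - 1))))
     \<subseteq> F i M (pairing l j) (pairing k l) (pairing j k)" (is "E i N \<inter> ?W \<subseteq> F i M ?R ?S ?T")
proof
  fix x assume x: "x \<in> E i N \<inter> ?W"
  have d': "distinct [l, k, j, i]" using d by auto
  define r s t where "r = count M ?R" and "s = count M ?S" and "t = count M ?T"
  have ne: "?R \<noteq> ?S" "?R \<noteq> ?T" "?S \<noteq> ?T" "?S \<noteq> ?R" "?T \<noteq> ?R" "?T \<noteq> ?S"
    using d pairing_eq_iff[of l j k] pairing_eq_iff[of j l k] pairing_eq_iff[of k l j]
    by (auto simp: pairing_commute)
  have cN: "count N ?R = Suc r" "count N ?S = s" "count N ?T = t"
    using ne by (simp_all add: N r_def s_def t_def)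
  obtain y z where yz: "x = y + z" and y: "y \<in> X i" "y \<in> A j k (Suc t)"
    and z: "z \<in> A k l (Suc s)" "z \<in> A l j r"
    using x by (auto simp: sup inf cN)
  have xA: "x \<in> X i" "x \<in> A j k t" "x \<in> A k l s" "x \<in> A l j r"
    by (rule E_gen[of x i N], use x in simp)
      (rule E_atomic[of x i N]; use x d d' in \<open>simp add: cN\<close>)+
  have zE: "z = x - y" "y = x - z" using yz by simp_all
  have "z \<in> X i" unfolding zE(1) using xA y by (intro diff) auto
  have "z \<in> A j k t"
    unfolding zE(1) using xA y atomic_antimono[of j k t "Suc t"] d by (intro diff) auto
  have "y \<in> A k l s"
    unfolding zE(2) using xA z atomic_antimono[of k l s "Suc s"] d by (intro diff) auto
  have "y \<in> A l j r" unfolding zE(2) using xA z by (intro diff) auto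
  have flip: "u \<in> X i \<Longrightarrow> u \<in> A l j r \<Longrightarrow> u \<in> A j l r" for u
    using d by (intro atomic_flip[of i l j]) auto
  have c: "pairing j l = ?R" by (rule pairing_commute)
  have "y \<in> E i (add_mset ?T M)"
    using y \<open>y \<in> A k l s\<close> \<open>y \<in> A l j r\<close> flip d d' ne
    by (intro E_I[of i j k l]) (simp_all add: c r_def s_def t_def)
  moreover have "z \<in> E i (add_mset ?S M)"
    using z \<open>z \<in> X i\<close> \<open>z \<in> A j k t\<close> flip d d' ne
    by (intro E_I[of i j k l]) (simp_all add: c r_def s_def t_def)
  ultimately show "x \<in> F i M ?R ?S ?T" using x unfolding F_def set_plus_eq N yz by blast
qed

end

section \<open>Four subgroups extend to a representation\<close>

fun eval :: "(idx \<Rightarrow> 'w::ab_group_add set) \<Rightarrow> lterm \<Rightarrow> 'w set" where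
  "eval Y (Gen i) = Y i"
| "eval Y (Join s t) = eval Y s + eval Y t"
| "eval Y (Meet s t) = eval Y s \<inter> eval Y t"

lemma subgroup_eval: "(\<And>i. add_subgroup (Y i)) \<Longrightarrow> add_subgroup (eval Y s)"
  by (induction s) (auto simp: add_subgroup_Int add_subgroup_sum set_plus_eq)

lemma subgroup_absorb:
  assumes "add_subgroup A" "add_subgroup B"
  shows "A + A \<inter> B = A" "A \<inter> (A + B) = A"
proof -
  show "A + A \<inter> B = A"
  proof
    show "A + A \<inter> B \<subseteq> A" using assms add_subgroup_add by (auto elim!: set_plus_elim)
    show "A \<subseteq> A + A \<inter> B"
      using assms set_plus_intro[of _ A 0 "A \<inter> B"] add_subgroup_zero by fastforce
  qed
  show "A \<inter> (A + B) = A"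
    using assms set_plus_intro[of _ A 0 B] add_subgroup_zero by fastforce
qed

lemma subgroup_modular:
  assumes "add_subgroup A" "add_subgroup B" "add_subgroup C"
  shows "A \<inter> C + B \<inter> C = (A \<inter> C + B) \<inter> C"
proof
  show "A \<inter> C + B \<inter> C \<subseteq> (A \<inter> C + B) \<inter> C"
    using assms add_subgroup_add by (auto elim!: set_plus_elim)
  show "(A \<inter> C + B) \<inter> C \<subseteq> A \<inter> C + B \<inter> C"
  proof
    fix x assume x: "x \<in> (A \<inter> C + B) \<inter> C"
    then obtain a b where ab: "a \<in> A \<inter> C" "b \<in> B" "x = a + b" by (auto elim!: set_plus_elim)
    then have "b = x - a" by simp
    then have "b \<in> C" using x ab assms(3) add_subgroup_diff by blast
    then show "x \<in> A \<inter> C + B \<inter> C" using ab by auto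
  qed
qed

lemma eval_cong:
  assumes "ml_eq s t" "\<And>i. add_subgroup (Y i)"
  shows "eval Y s = eval Y t"
proof -
  have sg: "add_subgroup (eval Y u)" for u using assms(2) by (rule subgroup_eval)
  show ?thesis
    using assms(1)
  proof (induction rule: ml_eq.induct)
    case (modular x z y)
    then show ?case using subgroup_modular[OF sg sg sg] by simp
  qed (use subgroup_absorb[OF sg sg] in \<open>simp_all add: ac_simps Int_ac\<close>)
qed

text \<open>The homomorphism given by the universal property of \<open>D\<^sup>4\<close>.\<close>

definition quadruple_rep :: "(idx \<Rightarrow> 'w::ab_group_add set) \<Rightarrow> d4 \<Rightarrow> 'w set" where
  "quadruple_rep Y a = (case a of top.Top \<Rightarrow> UNIV
     | top.Value bot.Bot \<Rightarrow> {0}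
     | top.Value (bot.Value f) \<Rightarrow> eval Y (rep_fm4 f))"

lemma rep_abs_fm4: "ml_eq (rep_fm4 (abs_fm4 s)) s"
  using Quotient3_rep_abs[OF Quotient3_fm4, of s] ml_eq.refl by blast

context
  fixes Y :: "idx \<Rightarrow> 'w::ab_group_add set"
  assumes Y: "\<And>i. add_subgroup (Y i)"
begin

lemma eval_sup: "eval Y (rep_fm4 (sup f g)) = eval Y (rep_fm4 f) + eval Y (rep_fm4 g)"
proof -
  have "sup f g = abs_fm4 (Join (rep_fm4 f) (rep_fm4 g))"
    by (simp add: sup_fm4_def)
  then show ?thesis using eval_cong[OF rep_abs_fm4 Y] by simp
qed

lemma eval_inf: "eval Y (rep_fm4 (inf f g)) = eval Y (rep_fm4 f) \<inter> eval Y (rep_fm4 g)"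
proof -
  have "inf f g = abs_fm4 (Meet (rep_fm4 f) (rep_fm4 g))"
    by (simp add: inf_fm4_def)
  then show ?thesis using eval_cong[OF rep_abs_fm4 Y] by simp
qed

lemma quadruple_rep_gen: "quadruple_rep Y (gen i) = Y i"
proof -
  have "fm4_gen i = abs_fm4 (Gen i)" by (simp add: fm4_gen_def)
  then show ?thesis
    using eval_cong[OF rep_abs_fm4[of "Gen i"] Y] by (simp add: quadruple_rep_def gen_def)
qed

lemma subgroup_plus_UNIV: "add_subgroup A \<Longrightarrow> A + UNIV = (UNIV :: 'w set)"
proof -
  assume "add_subgroup A"
  then have "0 + x \<in> A + UNIV" for x
    using add_subgroup_zero by (intro set_plus_intro) auto
  then show ?thesis by auto
qed

lemma subgroup_rep_quadruple_rep: "subgroup_rep (quadruple_rep Y)"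
proof
  show sg: "add_subgroup (quadruple_rep Y a)" for a
    using subgroup_eval[of Y] Y
    by (auto simp: quadruple_rep_def add_subgroup_def split: top.splits bot.splits)
  have z: "{0} + B = B" "B + {0} = B" for B :: "'w set"
    by (auto simp: set_plus_def)
  have e: "add_subgroup (eval Y s)" for s using subgroup_eval[of Y] Y by blast
  show "quadruple_rep Y (sup a b) = {u + v | u v. u \<in> quadruple_rep Y a \<and> v \<in> quadruple_rep Y b}" for a b
    unfolding set_plus_eq[symmetric]
    using subgroup_plus_UNIV[OF sg[of a]] subgroup_plus_UNIV[OF sg[of b]]
    by (cases a rule: top.exhaust; cases b rule: top.exhaust)
      (auto simp: quadruple_rep_def sup_top_def sup_bot_def eval_sup z add.commute split: bot.splits)
  show "quadruple_rep Y (inf a b) = quadruple_rep Y a \<inter> quadruple_rep Y b" for a b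
    using add_subgroup_zero[OF e]
    by (cases a rule: top.exhaust; cases b rule: top.exhaust)
      (auto simp: quadruple_rep_def inf_top_def inf_bot_def eval_inf split: bot.splits)
qed

end

section \<open>The reflected representation\<close>

text \<open>The induction compares quadruples in a group with quadruples in its fourth power, and both have to be
  of the same type. Functions on index lists allow this: four of them are packed into one by
  prefixing the index.\<close>

definition coord :: "idx \<Rightarrow> (idx list \<Rightarrow> 'v) \<Rightarrow> idx list \<Rightarrow> 'v" where
  "coord i v = (\<lambda>xs. v (i # xs))"

definition pack :: "(idx \<Rightarrow> idx list \<Rightarrow> 'v::zero) \<Rightarrow> idx list \<Rightarrow> 'v" where
  "pack c = (\<lambda>xs. case xs of [] \<Rightarrow> 0 | i # ys \<Rightarrow> c i ys)"

lemma coord_pack [simp]: "coord i (pack c) = c i"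
  by (simp add: coord_def pack_def)

lemma coord_add [simp]: "coord i (v + w) = coord i v + coord i w"
  and coord_diff [simp]: "coord i (v - w) = coord i v - coord i w"
  and coord_zero [simp]: "coord i 0 = 0"
  by (simp_all add: coord_def fun_eq_iff)

lemma sum_idx:
  fixes g :: "idx \<Rightarrow> 'b::comm_monoid_add"
  assumes "distinct [p, q, r, s]"
  shows "(\<Sum>i\<in>UNIV. g i) = g p + g q + g r + g s"
  unfolding UNIV_eq_distinct[OF assms] using assms by (simp add: add.assoc)

locale reflection = subgroup_rep \<rho> for \<rho> :: "d4 \<Rightarrow> (idx list \<Rightarrow> 'v::ab_group_add) set"
begin

text \<open>The group in which \<open>X\<^sup>+\<close> lives. The value of \<open>v\<close> at the empty list is left free, as the coordinates do
  not see it.\<close>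

definition total :: "(idx list \<Rightarrow> 'v) set" where
  "total = {v. (\<forall>i. coord i v \<in> X i) \<and> (\<Sum>i\<in>UNIV. coord i v) = 0}"

definition \<rho>' :: "d4 \<Rightarrow> (idx list \<Rightarrow> 'v) set" where
  "\<rho>' = quadruple_rep (\<lambda>m. {v \<in> total. coord m v = 0})"

lemma subgroup_total: "add_subgroup total"
  by (auto simp: add_subgroup_def total_def zero diff sum_subtractf)

lemma subgroup_kernel: "add_subgroup {v \<in> total. coord m v = 0}"
  using subgroup_total by (auto simp: add_subgroup_def)

sublocale R: subgroup_rep \<rho>'
  unfolding \<rho>'_def by (rule subgroup_rep_quadruple_rep) (rule subgroup_kernel)

lemma R_gen: "R.X m = {v \<in> total. coord m v = 0}"
  unfolding \<rho>'_def
  using quadruple_rep_gen[of "\<lambda>m. {v \<in> total. coord m v = 0}" m] subgroup_kernel by simp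

lemma R_top: "\<rho>' top = UNIV"
  by (simp add: \<rho>'_def quadruple_rep_def top_top_def)

lemma total_coord: "v \<in> total \<Longrightarrow> coord i v \<in> X i"
  by (simp add: total_def)

lemma total_sum:
  "v \<in> total \<Longrightarrow> distinct [p, q, r, s] \<Longrightarrow> coord p v + coord q v + coord r v + coord s v = 0"
  using sum_idx[of p q r s "\<lambda>i. coord i v"] by (simp add: total_def)

lemma total_eq_minus:
  assumes "v \<in> total" "distinct [p, q, r, s]" "coord q v = 0"
  shows "coord p v = - (coord r v + coord s v)"
proof -
  have "coord p v + (coord r v + coord s v) = 0"
    using total_sum[OF assms(1,2)] assms(3) by (simp add: add.assoc)
  then show ?thesis by (rule eq_neg_iff_add_eq_0[THEN iffD2])
qed

lemma total_exists:
  assumes d: "distinct [p, q, r, s]" and "a \<in> X p" "b \<in> X q" "c \<in> X r" "e \<in> X s" "a + b + c + e = 0"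
  obtains v where "v \<in> total" "coord p v = a" "coord q v = b" "coord r v = c" "coord s v = e"
proof -
  define v where "v = pack (\<lambda>i. if i = p then a else if i = q then b else if i = r then c else e)"
  have c: "coord p v = a" "coord q v = b" "coord r v = c" "coord s v = e"
    using d by (auto simp: v_def)
  have "coord i v \<in> X i" for i
  proof -
    have "i \<in> {p, q, r, s}" using UNIV_eq_distinct[OF d] by auto
    then show ?thesis using c assms by auto
  qed
  moreover have "(\<Sum>i\<in>UNIV. coord i v) = 0"
    unfolding sum_idx[OF d] c by (rule assms)
  ultimately have "v \<in> total" by (simp add: total_def)
  then show thesis using c by (rule that)
qed

text \<open>For \<open>v = u + w\<close> with \<open>u\<^sub>p = 0\<close> and \<open>w\<^sub>q = 0\<close>, the relation \<open>\<Sum> w\<^sub>i = 0\<close> says \<open>v\<^sub>p = - w\<^sub>s - w\<^sub>r\<close>, and by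
  induction \<open>w\<close> lies in \<open>a\<^sup>r\<^sup>s\<^sub>n\<close> iff \<open>w\<^sub>r\<close> lies in \<open>a\<^sup>p\<^sup>q\<^sub>n\<close>. So the condition on \<open>v\<close> is that \<open>v\<^sub>p\<close> decomposes
  according to \<open>a\<^sup>s\<^sup>r\<^sub>n\<^sub>+\<^sub>1\<close>.\<close>

lemma R_atomic:
  "v \<in> total \<Longrightarrow> distinct [p, q, r, s] \<Longrightarrow> v \<in> R.A p q n \<longleftrightarrow> coord p v \<in> A r s n"
proof (induction n arbitrary: v p q r s)
  case 0
  then show ?case using total_coord[of v p] atomic_zero[of p r s] by (auto simp: R_top)
next
  case (Suc n)
  note d = Suc.prems(2)
  have d': "distinct [r, s, p, q]" "distinct [s, r, p, q]" "distinct [p, s, r]" using d by auto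
  have vp: "coord p v \<in> X p" using Suc.prems(1) by (rule total_coord)
  show ?case
  proof
    assume "v \<in> R.A p q (Suc n)"
    then obtain u w where u: "u \<in> R.X p" and w: "w \<in> R.X q" "w \<in> R.A r s n" and v: "v = u + w"
      using d by (rule R.atomic_SucE)
    have wt: "w \<in> total" "coord q w = 0" "coord p u = 0" using w u by (simp_all add: R_gen)
    have "coord p v = - coord s w + - coord r w"
      using total_eq_minus[OF wt(1) d wt(2)] wt(3) by (simp add: v)
    moreover have "coord r w \<in> A p q n" using Suc.IH[OF wt(1) d'(1)] w by simp
    then have "- coord s w + - coord r w \<in> A s r (Suc n)"
      using total_coord[OF wt(1)] by (intro atomic_SucI[OF _ _ _ d'(2)] minus)
    ultimately have "coord p v \<in> A s r (Suc n)" by (simp only:)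
    then show "coord p v \<in> A r s (Suc n)" using vp d'(3) by (intro atomic_flip[of p s r])
  next
    assume "coord p v \<in> A r s (Suc n)"
    then have "coord p v \<in> A s r (Suc n)" using vp d by (intro atomic_flip[of p r s]) auto
    then obtain a b where a: "a \<in> X s" and b: "b \<in> X r" "b \<in> A p q n" and ab: "coord p v = a + b"
      using d'(2) by (rule atomic_SucE)
    obtain w where w: "w \<in> total" "coord p w = a + b" "coord q w = 0" "coord r w = - b" "coord s w = - a"
      using total_exists[OF d, of "a + b" 0 "- b" "- a"] vp ab a b zero minus by auto
    have "w \<in> R.A r s n" using Suc.IH[OF w(1) d'(1)] w(4) minus[OF b(2)] by (simp only:)
    moreover have "w \<in> R.X q" "v - w \<in> R.X p"
      using w ab Suc.prems(1) add_subgroup_diff[OF subgroup_total] by (simp_all add: R_gen)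
    ultimately have "(v - w) + w \<in> R.A p q (Suc n)" using d by (intro R.atomic_SucI)
    then show "v \<in> R.A p q (Suc n)" by simp
  qed
qed

section \<open>Lifting along the coordinate maps\<close>

text \<open>With \<open>v\<^sub>i = 0\<close>, membership of \<open>v\<close> in the factors of \<open>E\<^sub>i(M)\<close> for the pairs \<open>h, k\<close> and \<open>h, l\<close> is a condition on
  \<open>v\<^sub>h = x\<close> only, and the factor for \<open>k, l\<close> asks for a decomposition \<open>x = - v\<^sub>k - v\<^sub>l\<close> along \<open>a\<^sup>l\<^sup>k\<close> with one
  more step.\<close>

lemma lift_E:
  assumes "h \<noteq> i" "x \<in> E h (add_mset (pairing h i) M)"
  obtains v where "v \<in> R.E i M" "coord h v = x"
proof -
  obtain k l where d: "distinct [h, i, k, l]" using ex_distinct34[OF assms(1)] .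
  have d': "distinct [l, k, h, i]" "distinct [h, k, i, l]" "distinct [h, l, i, k]"
    "distinct [k, l, h, i]" "distinct [i, h, k, l]" "distinct [k, i, h]"
    using d by auto
  have P: "pairing l k = pairing h i" "pairing k l = pairing h i" "pairing i l = pairing h k"
    "pairing i k = pairing h l"
    using d d' by (auto intro!: pairing_complement)
  have "x \<in> A l k (Suc (count M (pairing h i)))"
    using d by (intro E_atomic[OF assms(2)]) (auto simp: P)
  then obtain a b where a: "a \<in> X l" and b: "b \<in> X k" "b \<in> A h i (count M (pairing h i))" and x: "x = a + b"
    using d'(1) by (rule atomic_SucE)
  have xX: "x \<in> X h" using assms(2) by (rule E_gen)
  obtain v where v: "v \<in> total" "coord h v = a + b" "coord i v = 0" "coord k v = - b" "coord l v = - a"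
    using total_exists[OF d, of "a + b" 0 "- b" "- a"] xX x a b zero minus by auto
  have "x \<in> A i l (count M (pairing h k))" "x \<in> A i k (count M (pairing h l))"
    using d d' by (auto intro!: E_atomic[OF assms(2)] simp: P)
  then have "v \<in> R.A h k (count M (pairing h k))" "v \<in> R.A h l (count M (pairing h l))"
    using R_atomic[OF v(1) d'(2)] R_atomic[OF v(1) d'(3)] v(2) x by simp_all
  moreover have "v \<in> R.A k l (count M (pairing k l))"
    using R_atomic[OF v(1) d'(4)] v(4) b minus by (simp add: P)
  moreover have "v \<in> R.X i" using v by (simp add: R_gen)
  ultimately have "v \<in> R.E i M" by (intro R.E_I[OF d'(5)])
  then show thesis using v(2) x by (intro that) auto
qed

text \<open>If \<open>c\<^sub>h = 0\<close> too, then only the factor for the pair \<open>k, l\<close> restricts \<open>c\<close>, and its pairing is that of \<open>h\<close> and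
  \<open>i\<close>.\<close>

lemma R_E_add_mset:
  assumes "h \<noteq> i" "c \<in> R.E i M" "coord h c = 0" "Q \<noteq> pairing h i"
  shows "c \<in> R.E i (add_mset Q M)"
proof -
  obtain k l where d: "distinct [h, i, k, l]" using ex_distinct34[OF assms(1)] .
  have d': "distinct [h, k, i, l]" "distinct [h, l, i, k]" "distinct [i, h, k, l]" using d by auto
  have c: "c \<in> R.X i" using assms(2) by (rule R.E_gen)
  then have t: "c \<in> total" by (simp add: R_gen)
  have "pairing k l = pairing h i" using d by (auto intro!: pairing_complement[symmetric])
  then have "c \<in> R.A k l (count (add_mset Q M) (pairing k l))"
    using d assms(4) by (intro R.E_atomic[OF assms(2)]) auto
  then show ?thesis
    using c R_atomic[OF t d'(1)] R_atomic[OF t d'(2)] assms(3) zero by (intro R.E_I[OF d'(3)]) simp_all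
qed

text \<open>Lift \<open>x\<close>, \<open>y\<close> and \<open>z\<close> separately to \<open>u\<close>, \<open>v\<close> and \<open>w\<close>. The defect \<open>c = v + w - u\<close> has \<open>c\<^sub>h = 0\<close>, so by
  \<open>R_E_add_mset\<close> it can be absorbed into \<open>v\<close> or \<open>w\<close>: at least one of \<open>S\<close> and \<open>T\<close> is not the pairing of \<open>h\<close> and
  \<open>i\<close>.\<close>

lemma lift_F:
  assumes hi: "h \<noteq> i" and ST: "S \<noteq> T" and x: "x \<in> F h (add_mset (pairing h i) M) R S T"
  obtains v where "v \<in> R.F i M R S T" "coord h v = x"
proof -
  let ?P = "pairing h i"
  obtain y z where xE: "x \<in> E h (add_mset ?P (add_mset R M))" and xyz: "x = y + z"
    and y: "y \<in> E h (add_mset ?P (add_mset T M))" and z: "z \<in> E h (add_mset ?P (add_mset S M))"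
    using x by (auto simp: F_def set_plus_eq add_mset_commute)
  obtain u where u: "u \<in> R.E i (add_mset R M)" "coord h u = x" using lift_E[OF hi xE] .
  obtain v where v: "v \<in> R.E i (add_mset T M)" "coord h v = y" using lift_E[OF hi y] .
  obtain w where w: "w \<in> R.E i (add_mset S M)" "coord h w = z" using lift_E[OF hi z] .
  define c where "c = v + w - u"
  have "R.E i (add_mset Q M) \<subseteq> R.E i M" for Q by (rule R.E_antimono) simp
  then have "u \<in> R.E i M" "v \<in> R.E i M" "w \<in> R.E i M" using u v w by blast+
  then have c: "c \<in> R.E i M" "coord h c = 0"
    using u v w by (simp_all add: c_def R.E_add R.E_diff xyz)
  have "u \<in> R.E i (add_mset T M) + R.E i (add_mset S M)"
  proof (cases "S = ?P")
    case False
    then have "w - c \<in> R.E i (add_mset S M)"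
      by (intro R.E_diff w R_E_add_mset[OF hi c])
    then have "v + (w - c) \<in> R.E i (add_mset T M) + R.E i (add_mset S M)" by (intro set_plus_intro v)
    then show ?thesis by (simp add: c_def)
  next
    case True
    then have "T \<noteq> ?P" using ST by simp
    then have "v - c \<in> R.E i (add_mset T M)"
      by (intro R.E_diff v R_E_add_mset[OF hi c])
    then have "(v - c) + w \<in> R.E i (add_mset T M) + R.E i (add_mset S M)" by (intro set_plus_intro w)
    then show ?thesis by (simp add: c_def)
  qed
  then show thesis using u by (intro that) (simp_all add: R.F_def)
qed

section \<open>Pushing forward along the coordinate maps\<close>

text \<open>As \<open>v\<^sub>i = 0\<close>, it suffices to control the other two coordinates \<open>v\<^sub>k\<close> and \<open>v\<^sub>l\<close>, and each of these is
  additive over the join.\<close>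

lemma coord_Sup_fin:
  assumes hi: "h \<noteq> i" and fin: "finite \<Gamma>" "\<Gamma> \<noteq> {}" and B: "add_subgroup B"
    and v: "v \<in> R.X i" "v \<in> \<rho>' (Sup_fin (g ` \<Gamma>))"
    and *: "\<And>\<gamma> k w. \<gamma> \<in> \<Gamma> \<Longrightarrow> k \<noteq> h \<Longrightarrow> k \<noteq> i \<Longrightarrow> w \<in> \<rho>' (g \<gamma>) \<Longrightarrow> coord k w \<in> B"
  shows "coord h v \<in> X h \<inter> B"
proof -
  have "coord k v \<in> B" if k: "k \<noteq> h" "k \<noteq> i" for k
  proof -
    have "add_subgroup {w. coord k w \<in> B}"
      using B by (auto simp: add_subgroup_def)
    then have "\<rho>' (Sup_fin (g ` \<Gamma>)) \<subseteq> {w. coord k w \<in> B}"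
      using fin *[OF _ k] by (intro R.Sup_fin_least) auto
    then show ?thesis using v(2) by blast
  qed
  moreover obtain k l where d: "distinct [h, i, k, l]" using ex_distinct34[OF hi] .
  ultimately have "coord k v \<in> B" "coord l v \<in> B" by auto
  then have "- (coord k v + coord l v) \<in> B"
    using B add_subgroup_add add_subgroup_minus by blast
  moreover have t: "v \<in> total" "coord i v = 0" using v(1) by (simp_all add: R_gen)
  then have "coord h v = - (coord k v + coord l v)"
    by (intro total_eq_minus[OF _ d])
  ultimately show ?thesis using total_coord[OF t(1), of h] by (metis IntI)
qed

lemma e_tilde_le_gen: "e_tilde \<alpha> \<le> gen (hd \<alpha>)"
  by (subst e_tilde.simps) simp

text \<open>If \<open>k\<close> is the head of \<open>\<gamma>\<close>, then \<open>e_tilde \<gamma>\<close> lies below \<open>e\<^sub>k\<close> and its \<open>k\<close>-th coordinates vanish. Otherwise \<open>k\<gamma>\<close> is one of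
  the sequences in the join for \<open>h\<alpha>\<close>.\<close>

lemma coord_Sup_e_tilde:
  assumes hi: "h \<noteq> i" and fin: "finite \<Gamma>" "\<Gamma> \<noteq> {}" "finite \<Gamma>'"
    and v: "v \<in> R.X i" "v \<in> \<rho>' (Sup_fin (e_tilde ` \<Gamma>))"
    and ext: "\<And>\<gamma> k. \<gamma> \<in> \<Gamma> \<Longrightarrow> k \<noteq> h \<Longrightarrow> k \<noteq> i \<Longrightarrow> k \<noteq> hd \<gamma> \<Longrightarrow> k # \<gamma> \<in> \<Gamma>'"
    and IH: "\<And>\<gamma> k w. \<gamma> \<in> \<Gamma> \<Longrightarrow> k \<noteq> hd \<gamma> \<Longrightarrow> w \<in> \<rho>' (e_tilde \<gamma>) \<Longrightarrow> coord k w \<in> \<rho> (e_tilde (k # \<gamma>))"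
  shows "coord h v \<in> X h \<inter> \<rho> (Sup_fin (e_tilde ` \<Gamma>'))"
proof (rule coord_Sup_fin[OF hi fin(1,2) subgroup v])
  fix \<gamma> k w assume \<gamma>: "\<gamma> \<in> \<Gamma>" and k: "k \<noteq> h" "k \<noteq> i" and w: "w \<in> \<rho>' (e_tilde \<gamma>)"
  show "coord k w \<in> \<rho> (Sup_fin (e_tilde ` \<Gamma>'))"
  proof (cases "k = hd \<gamma>")
    case True
    then have "w \<in> R.X k" using w R.mono[OF e_tilde_le_gen[of \<gamma>]] by auto
    then show ?thesis using zero by (simp add: R_gen)
  next
    case False
    then have "coord k w \<in> \<rho> (e_tilde (k # \<gamma>))" using IH \<gamma> w by blast
    moreover have "\<rho> (e_tilde (k # \<gamma>)) \<subseteq> \<rho> (Sup_fin (e_tilde ` \<Gamma>'))"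
      using ext[OF \<gamma> k False] fin(3) by (intro Sup_fin_upper) auto
    ultimately show ?thesis by blast
  qed
qed

lemma coord_e_tilde:
  "\<alpha> \<noteq> [] \<Longrightarrow> distinct_adj \<alpha> \<Longrightarrow> h \<noteq> hd \<alpha> \<Longrightarrow> v \<in> \<rho>' (e_tilde \<alpha>) \<Longrightarrow> coord h v \<in> \<rho> (e_tilde (h # \<alpha>))"
proof (induction \<alpha> arbitrary: h v rule: measure_induct_rule[where f = length])
  case (less \<alpha>)
  obtain i \<alpha>' where \<alpha>: "\<alpha> = i # \<alpha>'" using less.prems(1) by (cases \<alpha>) auto
  have hi: "h \<noteq> i" using less.prems(3) \<alpha> by simp
  have goal: "\<rho> (e_tilde (h # \<alpha>)) = X h \<inter> \<rho> (Sup_fin (e_tilde ` Gamma_e (h # \<alpha>)))"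
    by (subst e_tilde.simps) (simp add: \<alpha> inf)
  have vi: "v \<in> R.X i" using less.prems(4) R.mono[OF e_tilde_le_gen[of \<alpha>]] by (auto simp: \<alpha>)
  show ?case
  proof (cases \<alpha>')
    case Nil
    obtain k l where d: "distinct [h, i, k, l]" using ex_distinct34[OF hi] .
    have t: "v \<in> total" "coord i v = 0" using vi by (simp_all add: R_gen)
    have sub: "X m \<subseteq> \<rho> (Sup_fin (e_tilde ` Gamma_e (h # \<alpha>)))" if "m \<noteq> h" "m \<noteq> i" for m
    proof -
      have "[m] \<in> Gamma_e (h # \<alpha>)" using that by (simp add: \<alpha> Nil Gamma_e_Cons)
      then have "\<rho> (e_tilde [m]) \<subseteq> \<rho> (Sup_fin (e_tilde ` Gamma_e (h # \<alpha>)))"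
        by (intro Sup_fin_upper) auto
      then show ?thesis by (simp add: e_tilde.simps[of "[m]"])
    qed
    have "k \<noteq> h" "k \<noteq> i" "l \<noteq> h" "l \<noteq> i" using d by auto
    then have "coord k v \<in> \<rho> (Sup_fin (e_tilde ` Gamma_e (h # \<alpha>)))"
      "coord l v \<in> \<rho> (Sup_fin (e_tilde ` Gamma_e (h # \<alpha>)))"
      using subsetD[OF sub] total_coord[OF t(1)] by blast+
    then have "- (coord k v + coord l v) \<in> \<rho> (Sup_fin (e_tilde ` Gamma_e (h # \<alpha>)))"
      by (intro minus add)
    moreover have "coord h v = - (coord k v + coord l v)"
      using t by (intro total_eq_minus[OF _ d])
    ultimately show ?thesis unfolding goal using total_coord[OF t(1), of h] by (metis IntI)
  next
    case (Cons j \<alpha>'')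
    then have len: "length \<alpha> \<ge> 2" by (simp add: \<alpha>)
    then have "e_tilde \<alpha> = inf (gen (hd \<alpha>)) (Sup_fin (e_tilde ` Gamma_e \<alpha>))"
      by (subst e_tilde.simps) simp
    then have "v \<in> \<rho>' (Sup_fin (e_tilde ` Gamma_e \<alpha>))"
      using less.prems(4) by (simp add: R.inf)
    then show ?thesis
      unfolding goal
    proof (rule coord_Sup_e_tilde[OF hi finite_Gamma_e Gamma_e_nonempty[OF less.prems(1)] finite_Gamma_e vi])
      show "k # \<gamma> \<in> Gamma_e (h # \<alpha>)"
        if "\<gamma> \<in> Gamma_e \<alpha>" "k \<noteq> h" "k \<noteq> i" "k \<noteq> hd \<gamma>" for \<gamma> k
        using that by (simp add: \<alpha> Gamma_e_Cons)
      show "coord k w \<in> \<rho> (e_tilde (k # \<gamma>))"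
        if "\<gamma> \<in> Gamma_e \<alpha>" "k \<noteq> hd \<gamma>" "w \<in> \<rho>' (e_tilde \<gamma>)" for \<gamma> k w
        using that Gamma_e_D[OF that(1) len] by (intro less.IH) auto
    qed
  qed
qed

lemma coord_f0_tilde:
  assumes "\<alpha> \<noteq> []" "distinct_adj \<alpha>" "h \<noteq> hd \<alpha>" "v \<in> \<rho>' (f0_tilde \<alpha>)"
  shows "coord h v \<in> \<rho> (f0_tilde (h # \<alpha>))"
proof -
  obtain i \<alpha>' where \<alpha>: "\<alpha> = i # \<alpha>'" using assms(1) by (cases \<alpha>) auto
  have hi: "h \<noteq> i" using assms(3) \<alpha> by simp
  have vi: "v \<in> R.X i" and v: "v \<in> \<rho>' (Sup_fin (e_tilde ` Gamma_f \<alpha>))"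
    using assms(4) by (simp_all add: f0_tilde_def R.inf \<alpha>)
  have "coord h v \<in> X h \<inter> \<rho> (Sup_fin (e_tilde ` Gamma_f (h # \<alpha>)))"
    using v
  proof (rule coord_Sup_e_tilde[OF hi finite_Gamma_f Gamma_f_nonempty[OF assms(1)] finite_Gamma_f vi])
    show "k # \<gamma> \<in> Gamma_f (h # \<alpha>)"
      if "\<gamma> \<in> Gamma_f \<alpha>" "k \<noteq> h" "k \<noteq> i" "k \<noteq> hd \<gamma>" for \<gamma> k
      using that by (simp add: \<alpha> Gamma_f_Cons)
    show "coord k w \<in> \<rho> (e_tilde (k # \<gamma>))"
      if "\<gamma> \<in> Gamma_f \<alpha>" "k \<noteq> hd \<gamma>" "w \<in> \<rho>' (e_tilde \<gamma>)" for \<gamma> k w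
      using that Gamma_f_D[OF that(1) assms(1)] by (intro coord_e_tilde) auto
  qed
  then show ?thesis by (simp add: f0_tilde_def inf)
qed

end

section \<open>Lower bounds for the Gelfand--Ponomarev elements\<close>

lemma E_subset_e_tilde:
  fixes \<rho> :: "d4 \<Rightarrow> (idx list \<Rightarrow> 'v::ab_group_add) set"
  assumes "subgroup_rep \<rho>" "\<alpha> \<noteq> []" "distinct_adj \<alpha>"
  shows "subgroup_rep.E \<rho> (hd \<alpha>) (steps \<alpha>) \<subseteq> \<rho> (e_tilde \<alpha>)"
  using assms
proof (induction \<alpha> arbitrary: \<rho> rule: induct_list012)
  case 1
  then show ?case by simp
next
  case (2 i)
  then interpret subgroup_rep \<rho> by simp
  show ?case using E_gen by (auto simp: e_tilde.simps[of "[i]"])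
next
  case (3 h i \<alpha>)
  then interpret reflection \<rho> by (intro reflection.intro)
  have hi: "h \<noteq> i" and da: "distinct_adj (i # \<alpha>)" using 3 by auto
  have IH: "R.E i (steps (i # \<alpha>)) \<subseteq> \<rho>' (e_tilde (i # \<alpha>))"
    using 3(2)[OF R.subgroup_rep_axioms _ da] by simp
  show ?case
  proof
    fix x assume "x \<in> E (hd (h # i # \<alpha>)) (steps (h # i # \<alpha>))"
    then have "x \<in> E h (add_mset (pairing h i) (steps (i # \<alpha>)))" by simp
    then obtain v where v: "v \<in> R.E i (steps (i # \<alpha>))" "coord h v = x" using lift_E[OF hi] by blast
    then have "v \<in> \<rho>' (e_tilde (i # \<alpha>))" using IH by blast
    then have "coord h v \<in> \<rho> (e_tilde (h # i # \<alpha>))"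
      using hi da by (intro coord_e_tilde) auto
    then show "x \<in> \<rho> (e_tilde (h # i # \<alpha>))" using v by simp
  qed
qed

definition all_pairings :: "idx set set \<Rightarrow> idx set set \<Rightarrow> idx set set \<Rightarrow> bool" where
  "all_pairings R S T \<longleftrightarrow>
     (\<exists>a b c d. distinct [a, b, c, d] \<and> R = pairing a b \<and> S = pairing a c \<and> T = pairing a d)"

lemma all_pairings_at:
  assumes "all_pairings R S T"
  obtains p q w where "distinct [h, p, q, w]" "R = pairing h p" "S = pairing h q" "T = pairing h w"
proof -
  obtain a b c d where d: "distinct [a, b, c, d]" and R: "R = pairing a b" "S = pairing a c" "T = pairing a d"
    using assms by (auto simp: all_pairings_def)
  have e: "pairing a b = pairing c d" "pairing a c = pairing b d" "pairing a d = pairing b c"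
    using d by (auto intro!: pairing_complement)
  have d': "distinct [d, c, b, a]" using d by auto
  have "h \<in> {a, b, c, d}" using UNIV_eq_distinct[OF d] by auto
  then consider "h = a" | "h = b" | "h = c" | "h = d" by blast
  then show thesis
  proof cases
    case 1 then show ?thesis using that[of b c d] d R by simp
  next
    case 2 then show ?thesis using that[of a d c] d d' R e by (simp add: pairing_commute)
  next
    case 3 then show ?thesis using that[of d a b] d d' R e by (simp add: pairing_commute)
  next
    case 4 then show ?thesis using that[of c b a] d d' R e by (simp add: pairing_commute)
  qed
qed

lemma all_pairingsI:
  "distinct [a, b, c, d] \<Longrightarrow> all_pairings (pairing a b) (pairing a c) (pairing a d)"
  unfolding all_pairings_def by blast

lemma all_pairings_distinct:
  assumes "all_pairings R S T"
  shows "R \<noteq> S" "S \<noteq> T" "R \<noteq> T"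
proof -
  obtain a b c d where "distinct [a, b, c, d]" "R = pairing a b" "S = pairing a c" "T = pairing a d"
    using assms unfolding all_pairings_def by blast
  then show "R \<noteq> S" "S \<noteq> T" "R \<noteq> T"
    using pairing_eq_iff[of a b c] pairing_eq_iff[of a c d] pairing_eq_iff[of a b d] by simp_all
qed

lemma all_pairings_swap: "all_pairings R S T \<Longrightarrow> all_pairings R T S"
  and all_pairings_rotate: "all_pairings R S T \<Longrightarrow> all_pairings T S R"
proof -
  assume "all_pairings R S T"
  then obtain a b c d where d: "distinct [a, b, c, d]"
    and RST: "R = pairing a b" "S = pairing a c" "T = pairing a d"
    unfolding all_pairings_def by blast
  have "distinct [a, b, d, c]" "distinct [a, d, c, b]" using d by auto
  then show "all_pairings R T S" "all_pairings T S R" unfolding RST by (blast intro: all_pairingsI)+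
qed

lemma all_pairings_exhaust:
  assumes "all_pairings R S T" "p \<noteq> q"
  shows "pairing p q = R \<or> pairing p q = S \<or> pairing p q = T"
proof -
  obtain a b c d where "distinct [a, b, c, d]" "R = pairing a b" "S = pairing a c" "T = pairing a d"
    using assms(1) unfolding all_pairings_def by blast
  then show ?thesis using pairing_cases[of a b c d p q] assms(2) by simp
qed

lemma steps_pairing: "P \<in># steps \<alpha> \<Longrightarrow> distinct_adj \<alpha> \<Longrightarrow> \<exists>p q. p \<noteq> q \<and> P = pairing p q"
  by (induction \<alpha> rule: induct_list012) auto

lemma (in subgroup_rep) F_relabel_pairings:
  assumes "all_pairings R S T"
  shows "F h (add_mset T M) R S T \<subseteq> F h (add_mset R M) T S R"
proof -
  obtain w' p' q' where d: "distinct [h, w', p', q']"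
    and RST: "R = pairing h w'" "S = pairing h p'" "T = pairing h q'"
    using assms by (rule all_pairings_at)
  have "distinct [h, q', p', w']" using d by auto
  moreover have "R = pairing q' p'" "S = pairing q' w'" "T = pairing p' w'"
    unfolding RST using d by (auto intro!: pairing_complement)
  ultimately show ?thesis by (rule F_relabel)
qed

text \<open>The induction step lifts along the last step of the sequence. What remains has to contain the pairing that
  is singled out, so \<open>F_relabel_pairings\<close> is used to single out a step \<open>Q\<close> of the shorter sequence.
  Sequences of length 2 leave no such step and are treated directly, again in the reflected quadruple.\<close>

lemma F_subset_f0_tilde:
  fixes \<rho> :: "d4 \<Rightarrow> (idx list \<Rightarrow> 'v::ab_group_add) set"
  assumes "subgroup_rep \<rho>" "length \<alpha> \<ge> 2" "distinct_adj \<alpha>"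
    and "all_pairings R S T" "steps \<alpha> = add_mset R M"
  shows "subgroup_rep.F \<rho> (hd \<alpha>) M R S T \<subseteq> \<rho> (f0_tilde \<alpha>)"
  using assms
proof (induction \<alpha> arbitrary: \<rho> R S T M rule: induct_list012)
  case 1
  then show ?case by simp
next
  case (2 i)
  then show ?case by simp
next
  case (3 h i \<alpha>)
  then interpret reflection \<rho> by (intro reflection.intro)
  have hi: "h \<noteq> i" and da: "distinct_adj (i # \<alpha>)" using 3 by auto
  let ?P = "pairing h i"
  have push: "coord h v \<in> \<rho> (f0_tilde (h # i # \<alpha>))" if "v \<in> \<rho>' (f0_tilde (i # \<alpha>))" for v
    using that hi da by (intro coord_f0_tilde) auto
  show ?case
  proof (cases \<alpha>)
    case Nil
    have R: "R = ?P" "M = {#}" using 3(7) by (simp_all add: Nil)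
    obtain i0 k l where d0: "distinct [h, i0, k, l]" and RST: "R = pairing h i0" "S = pairing h k" "T = pairing h l"
      using 3(6) by (rule all_pairings_at)
    have "i0 = i" using R RST d0 hi pairing_eq_iff[of h i0 i] by auto
    with d0 have d: "distinct [h, i, k, l]" by simp
    have d': "distinct [i, k, h, l]" "distinct [i, l, h, k]" "distinct [h, k, i, l]" using d by auto
    have ST: "S = pairing i l" "T = pairing i k" unfolding RST using d by (auto intro!: pairing_complement)
    have single: "R.X m \<subseteq> \<rho>' (Sup_fin (e_tilde ` Gamma_f [i]))" if "m \<noteq> i" for m
    proof -
      have "\<rho>' (e_tilde [m]) \<subseteq> \<rho>' (Sup_fin (e_tilde ` Gamma_f [i]))"
        using that by (intro R.Sup_fin_upper) (auto simp: Gamma_f_single)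
      then show ?thesis by (simp add: e_tilde.simps[of "[m]"])
    qed
    show ?thesis
    proof
      fix x assume "x \<in> F (hd (h # i # \<alpha>)) M R S T"
      then obtain y z where xE: "x \<in> E h (add_mset ?P {#})" and xyz: "x = y + z"
        and y: "y \<in> E h (add_mset T {#})" and z: "z \<in> E h (add_mset S {#})"
        by (auto simp: F_def set_plus_eq R)
      obtain u where u: "u \<in> R.E i {#}" "coord h u = x" using lift_E[OF hi xE] .
      have uX: "u \<in> R.X i" using u(1) by (rule R.E_gen)
      have "y \<in> A i k (Suc 0)" "z \<in> A i l (Suc 0)"
        using d by (auto intro!: E_atomic[OF y] E_atomic[OF z] simp: ST)
      then obtain i1 k1 i2 l2 where i1: "i1 \<in> X i" "k1 \<in> X k" "y = i1 + k1"
        and i2: "i2 \<in> X i" "l2 \<in> X l" "z = i2 + l2"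
        using atomic_SucE[OF _ d'(1)] atomic_SucE[OF _ d'(2)] by metis
      \<comment> \<open>\<open>u\<close> is split into elements of the generators \<open>l\<close>, \<open>k\<close> and \<open>h\<close>\<close>
      obtain v where v: "v \<in> total" "coord h v = y" "coord i v = - i1" "coord k v = - k1" "coord l v = 0"
        using total_exists[OF d, of y "- i1" "- k1" 0] E_gen[OF y] i1 minus zero by auto
      obtain w where w: "w \<in> total" "coord h w = z" "coord i w = - i2" "coord k w = 0" "coord l w = - l2"
        using total_exists[OF d, of z "- i2" 0 "- l2"] E_gen[OF z] i2 minus zero by auto
      have "v \<in> R.X l" "w \<in> R.X k" using v w by (simp_all add: R_gen)
      moreover have "u - v - w \<in> R.X h"
        using u uX v w xyz add_subgroup_diff[OF subgroup_total] by (simp add: R_gen)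
      ultimately have "(u - v - w) + v + w \<in> \<rho>' (Sup_fin (e_tilde ` Gamma_f [i]))"
        using single[of l] single[of k] single[of h] d by (intro R.add) auto
      then have "u \<in> \<rho>' (f0_tilde [i])"
        using uX by (simp add: f0_tilde_def R.inf)
      then show "x \<in> \<rho> (f0_tilde (h # i # \<alpha>))" using push u(2) by (auto simp: Nil)
    qed
  next
    case (Cons j \<alpha>')
    then have len: "length (i # \<alpha>) \<ge> 2" by simp
    obtain Q M' where Q: "steps (i # \<alpha>) = add_mset Q M'" by (simp add: Cons)
    have QM: "add_mset R M = add_mset ?P (add_mset Q M')" using 3(7) by (simp add: Q)
    have *: "F h (add_mset ?P M') Q S' T' \<subseteq> \<rho> (f0_tilde (h # i # \<alpha>))" if ap: "all_pairings Q S' T'" for S' T'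
    proof
      fix x assume "x \<in> F h (add_mset ?P M') Q S' T'"
      then obtain v where v: "v \<in> R.F i M' Q S' T'" "coord h v = x"
        using lift_F[OF hi all_pairings_distinct(2)[OF ap], of x M'] by blast
      then have "v \<in> \<rho>' (f0_tilde (i # \<alpha>))"
        using 3(2)[OF R.subgroup_rep_axioms len da ap Q] by auto
      then show "x \<in> \<rho> (f0_tilde (h # i # \<alpha>))" using push v(2) by blast
    qed
    have **: "F h M R S' Q \<subseteq> \<rho> (f0_tilde (h # i # \<alpha>))" if ap: "all_pairings R S' Q" for S'
    proof -
      have "R \<noteq> Q" using all_pairings_distinct(3)[OF ap] .
      moreover have "Q \<in># add_mset R M" unfolding QM by simp
      ultimately have "Q \<in># M" by simp
      then obtain M0 where M0: "M = add_mset Q M0" by (rule multi_member_split[THEN exE])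
      then have "add_mset R M0 = add_mset ?P M'" using QM by (simp add: add_mset_commute)
      then show ?thesis
        using F_relabel_pairings[OF ap, of h M0] *[OF all_pairings_rotate[OF ap]] M0 by simp
    qed
    have "Q \<in># steps (i # \<alpha>)" unfolding Q by simp
    then obtain p q where "p \<noteq> q" "Q = pairing p q" using steps_pairing da by blast
    then consider "Q = R" | "Q = S" | "Q = T" using all_pairings_exhaust[OF 3(6), of p q] by auto
    then show ?thesis
    proof cases
      case 1
      then have "M = add_mset ?P M'" using QM by (simp add: add_mset_commute)
      then show ?thesis using *[of S T] 3(6) 1 by simp
    next
      case 2
      then show ?thesis using **[of T] all_pairings_swap[OF 3(6)] by (simp add: F_swap)
    next
      case 3
      then show ?thesis using **[of S] \<open>all_pairings R S T\<close> by simp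
    qed
  qed
qed

section \<open>Admissible sequences up to equivalence\<close>

lemma steps_append: "steps (xs @ b # ys) = steps (xs @ [b]) + steps (b # ys)"
  by (induction xs rule: induct_list012) simp_all

lemma move_steps: "move \<alpha> \<beta> \<Longrightarrow> steps \<alpha> = steps \<beta>"
proof (induction rule: move.induct)
  case (1 i j k l xs ys)
  then have "pairing i j = pairing k l" "pairing j l = pairing i k"
    by (auto intro!: pairing_complement)
  then show ?case
    using steps_append[of xs i "j # l # ys"] steps_append[of xs i "k # l # ys"]
    by (simp add: add_mset_commute)
qed

lemma seq_equiv_steps: "seq_equiv \<alpha> \<beta> \<Longrightarrow> steps \<alpha> = steps \<beta>"
  unfolding seq_equiv_def by (induction rule: rtranclp_induct) (simp_all add: move_steps)

lemma seq_equiv_hd: "seq_equiv \<alpha> \<beta> \<Longrightarrow> hd \<alpha> = hd \<beta>"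
  unfolding seq_equiv_def
proof (induction rule: rtranclp_induct)
  case (step \<beta> \<gamma>)
  from step(2) have "hd \<beta> = hd \<gamma>"
    by cases (simp add: hd_append)
  with step show ?case by simp
qed simp

lemma seq_equiv_map:
  assumes "inj \<tau>" "seq_equiv \<alpha> \<beta>"
  shows "seq_equiv (map \<tau> \<alpha>) (map \<tau> \<beta>)"
  using assms(2) unfolding seq_equiv_def
proof (induction rule: rtranclp_induct)
  case (step \<beta> \<gamma>)
  from step(2) have "move (map \<tau> \<beta>) (map \<tau> \<gamma>)"
  proof cases
    case (1 i j k l xs ys)
    then have "distinct [\<tau> i, \<tau> j, \<tau> k, \<tau> l]" using assms(1) by (auto simp: inj_eq)
    from move.intros[OF this, of "map \<tau> xs" "map \<tau> ys"] show ?thesis using 1 by simp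
  qed
  with step show ?case by (simp add: rtranclp.rtrancl_into_rtrancl)
qed simp

lemma seq_equiv_append:
  assumes "seq_equiv \<alpha> \<beta>"
  shows "seq_equiv (\<alpha> @ zs) (\<beta> @ zs)"
  using assms unfolding seq_equiv_def
proof (induction rule: rtranclp_induct)
  case (step \<beta> \<gamma>)
  from step(2) have "move (\<beta> @ zs) (\<gamma> @ zs)"
  proof cases
    case (1 i j k l xs ys)
    from move.intros[OF 1(3), of xs "ys @ zs"] show ?thesis using 1 by simp
  qed
  with step show ?case by (simp add: rtranclp.rtrancl_into_rtrancl)
qed simp

lemma seq_equiv_trans: "seq_equiv \<alpha> \<beta> \<Longrightarrow> seq_equiv \<beta> \<gamma> \<Longrightarrow> seq_equiv \<alpha> \<gamma>"
  unfolding seq_equiv_def by (rule rtranclp_trans)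

lemma snoc2E:
  assumes "length xs \<ge> 2"
  obtains ys c a where "xs = ys @ [c, a]"
proof -
  obtain zs a where xs: "xs = zs @ [a]" using assms by (cases xs rule: rev_cases) auto
  obtain ys c where "zs = ys @ [c]" using assms xs by (cases zs rule: rev_cases) auto
  then have "xs = ys @ [c, a]" using xs by simp
  then show thesis by (rule that)
qed

text \<open>A move interchanges the two steps of \<open>bca\<close>, because the fourth index \<open>d\<close> gives \<open>da\<close> the pairing of \<open>bc\<close>.
  So any step can be carried to the start of the sequence, as in bubble sort.\<close>

lemma bring_step_to_start:
  assumes "P \<in># steps \<alpha>" "distinct_adj \<alpha>"
  shows "\<exists>xs b. seq_equiv \<alpha> (xs @ [b, last \<alpha>]) \<and> pairing b (last \<alpha>) = P \<and> distinct_adj (xs @ [b, last \<alpha>])"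
  using assms
proof (induction \<alpha> rule: measure_induct_rule[where f = length])
  case (less \<alpha>)
  then have "length \<alpha> \<ge> 2" by (cases \<alpha> rule: steps.cases) auto
  then obtain ys c a where \<alpha>: "\<alpha> = ys @ [c, a]" by (rule snoc2E)
  have ca: "c \<noteq> a" "distinct_adj (ys @ [c])" using less.prems(2) by (auto simp: \<alpha> distinct_adj_append_iff)
  show ?case
  proof (cases "pairing c a = P")
    case True
    then have "seq_equiv \<alpha> (ys @ [c, last \<alpha>]) \<and> pairing c (last \<alpha>) = P \<and> distinct_adj (ys @ [c, last \<alpha>])"
      using less.prems(2) by (simp add: \<alpha> seq_equiv_def)
    then show ?thesis by blast
  next
    case False
    then have "P \<in># steps (ys @ [c])"
      using less.prems(1) steps_append[of ys c "[a]"] by (simp add: \<alpha>)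
    then obtain xs b where xs: "seq_equiv (ys @ [c]) (xs @ [b, c])" "pairing b c = P" "distinct_adj (xs @ [b, c])"
      using less.IH[of "ys @ [c]"] ca by (auto simp: \<alpha>)
    have bc: "b \<noteq> c" "distinct_adj (xs @ [b])" using xs(3) by (auto simp: distinct_adj_append_iff)
    have "b \<noteq> a" using False xs(2) pairing_commute by auto
    then have "distinct [b, c, a]" using bc ca by auto
    then obtain d where d: "distinct [b, c, a, d]" by (rule ex_distinct4)
    then have "move (xs @ [b, c, a]) (xs @ [b, d, a])"
      using move.intros[of b c d a xs "[]"] by auto
    moreover have "seq_equiv \<alpha> (xs @ [b, c, a])"
      using seq_equiv_append[OF xs(1), of "[a]"] by (simp add: \<alpha>)
    ultimately have "seq_equiv \<alpha> ((xs @ [b]) @ [d, a])"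
      unfolding seq_equiv_def by (simp add: rtranclp.rtrancl_into_rtrancl)
    moreover have "pairing d a = P"
      using pairing_complement[OF d] xs(2) by (simp add: pairing_commute)
    moreover have "distinct_adj ((xs @ [b]) @ [d, a])"
      using bc d by (auto simp: distinct_adj_append_iff)
    ultimately have "seq_equiv \<alpha> ((xs @ [b]) @ [d, last \<alpha>]) \<and> pairing d (last \<alpha>) = P
        \<and> distinct_adj ((xs @ [b]) @ [d, last \<alpha>])" by (simp add: \<alpha>)
    then show ?thesis by blast
  qed
qed

text \<open>Carry the first step of \<open>\<beta>\<close> to the start of \<open>\<alpha>\<close>. The two sequences then agree in their first two entries,
  because the start and the first step determine the second entry, and the start can be removed.\<close>

lemma seq_equiv_if_steps_eq:
  assumes "distinct_adj \<alpha>" "distinct_adj \<beta>" "\<alpha> \<noteq> []" "\<beta> \<noteq> []" "last \<alpha> = last \<beta>" "steps \<alpha> = steps \<beta>"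
  shows "seq_equiv \<alpha> \<beta>"
  using assms
proof (induction \<beta> arbitrary: \<alpha> rule: measure_induct_rule[where f = length])
  case (less \<beta>)
  show ?case
  proof (cases "length \<beta> \<ge> 2")
    case False
    then obtain b where "\<beta> = [b]" using less.prems(4) by (cases \<beta>; cases "tl \<beta>") auto
    moreover from this have "\<alpha> = [b]" using less.prems by (cases \<alpha> rule: steps.cases) auto
    ultimately show ?thesis by (simp add: seq_equiv_def)
  next
    case True
    then obtain ys c a where \<beta>: "\<beta> = ys @ [c, a]" by (rule snoc2E)
    have ca: "c \<noteq> a" "distinct_adj (ys @ [c])" using less.prems(2) by (auto simp: \<beta> distinct_adj_append_iff)
    have "pairing c a \<in># steps \<alpha>" using less.prems(6) steps_append[of ys c "[a]"] by (simp add: \<beta>)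
    then obtain xs b where xs: "seq_equiv \<alpha> (xs @ [b, a])" "pairing b a = pairing c a" "distinct_adj (xs @ [b, a])"
      using bring_step_to_start[of "pairing c a" \<alpha>] less.prems(1,5) by (simp add: \<beta>) blast
    have ba: "b \<noteq> a" "distinct_adj (xs @ [b])" using xs(3) by (auto simp: distinct_adj_append_iff)
    have "b = c" using xs(2) ba ca pairing_eq_iff[of a b c] by (simp add: pairing_commute)
    have "steps (xs @ [b]) = steps (ys @ [c])"
      using seq_equiv_steps[OF xs(1)] less.prems(6) xs(2) steps_append[of ys c "[a]"] steps_append[of xs b "[a]"]
      by (simp add: \<beta>)
    then have "seq_equiv (xs @ [b]) (ys @ [c])"
      using less.IH[of "ys @ [c]" "xs @ [b]"] ba ca \<open>b = c\<close> by (simp add: \<beta>)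
    from seq_equiv_append[OF this, of "[a]"] have "seq_equiv (xs @ [b, a]) \<beta>" by (simp add: \<beta>)
    with xs(1) show ?thesis by (rule seq_equiv_trans)
  qed
qed

section \<open>The eight families of expressions\<close>

lemma pairing_idx:
  "pairing N2 N1 = pairing N1 N2" "pairing N3 N4 = pairing N1 N2" "pairing N4 N3 = pairing N1 N2"
  "pairing N3 N1 = pairing N1 N3" "pairing N2 N4 = pairing N1 N3" "pairing N4 N2 = pairing N1 N3"
  "pairing N4 N1 = pairing N1 N4" "pairing N2 N3 = pairing N1 N4" "pairing N3 N2 = pairing N1 N4"
  using pairing_complement[of N3 N4 N1 N2] pairing_complement[of N4 N3 N1 N2]
    pairing_complement[of N2 N4 N1 N3] pairing_complement[of N4 N2 N1 N3]
    pairing_complement[of N2 N3 N1 N4] pairing_complement[of N3 N2 N1 N4] pairing_commute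
  by simp_all

lemma pairing_idx_neq:
  "pairing N1 N2 \<noteq> pairing N1 N3" "pairing N1 N2 \<noteq> pairing N1 N4" "pairing N1 N3 \<noteq> pairing N1 N4"
  "pairing N1 N3 \<noteq> pairing N1 N2" "pairing N1 N4 \<noteq> pairing N1 N2" "pairing N1 N4 \<noteq> pairing N1 N3"
  by (simp_all add: pairing_eq_iff)

definition step_mset :: "nat \<Rightarrow> nat \<Rightarrow> nat \<Rightarrow> idx set set multiset" where
  "step_mset a b c = replicate_mset a (pairing N1 N2) + replicate_mset b (pairing N1 N3)
     + replicate_mset c (pairing N1 N4)"

lemma count_step_mset:
  "count (step_mset a b c) (pairing N1 N2) = a"
  "count (step_mset a b c) (pairing N1 N3) = b"
  "count (step_mset a b c) (pairing N1 N4) = c"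
  using pairing_idx_neq by (simp_all add: step_mset_def)

lemma rpt_0 [simp]: "rpt p q 0 = []"
  and rpt_Suc [simp]: "rpt p q (Suc t) = p # q # rpt p q t"
  by (simp_all add: rpt_def)

lemma steps_rpt: "steps (q # rpt p q t @ zs) = replicate_mset (2 * t) (pairing p q) + steps (q # zs)"
  by (induction t) (simp_all add: pairing_commute)

lemma distinct_adj_rpt: "p \<noteq> q \<Longrightarrow> distinct_adj (q # rpt p q t @ zs) \<longleftrightarrow> distinct_adj (q # zs)"
  by (induction t) auto

lemma last_rpt: "last (q # rpt p q t @ zs) = last (q # zs)"
  by (induction t) auto

lemma last_Cons_Cons: "last (x # y # zs) = last (y # zs)" "last [x] = x"
  by simp_all

lemmas rpt_simps = steps_rpt steps_rpt[where zs = "[]", unfolded append_Nil2]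
  distinct_adj_rpt distinct_adj_rpt[where zs = "[]", unfolded append_Nil2]
  last_rpt last_rpt[where zs = "[]", unfolded append_Nil2] last_Cons_Cons

text \<open>The expression attached to the sequences from 1 with \<open>a\<close>, \<open>b\<close>, \<open>c\<close> steps of the pairings of \<open>12\<close>, \<open>13\<close>, \<open>14\<close>. The
  eight families correspond to the parities of \<open>a\<close>, \<open>b\<close>, \<open>c\<close>, and the exponents are these multiplicities.\<close>

definition canonical_expr :: "nat \<Rightarrow> nat \<Rightarrow> nat \<Rightarrow> idx expr" where
  "canonical_expr a b c =
     (if even a then
        if even b then
          if even c then Expr N1 [(N2, N4, b), (N3, N4, a), (N3, N2, c)]
          else Expr N4 [(N2, N1, a), (N3, N1, b), (N3, N2, c)]
        else
          if even c then Expr N3 [(N2, N1, a), (N4, N1, c), (N2, N4, b)]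
          else Expr N2 [(N3, N4, a), (N3, N1, b), (N1, N4, c)]
      else
        if even b then
          if even c then Expr N2 [(N3, N1, b), (N4, N1, c), (N3, N4, a)]
          else Expr N3 [(N2, N4, b), (N2, N1, a), (N1, N4, c)]
        else
          if even c then Expr N4 [(N3, N2, c), (N3, N1, b), (N1, N2, a)]
          else Expr N1 [(N2, N3, c), (N2, N4, b), (N3, N4, a)])"

fun expr_gen :: "'i expr \<Rightarrow> 'i" where
  "expr_gen (Expr i fs) = i"

lemma canonical_data:
  assumes "canonical \<beta> F"
  shows "\<exists>a b c. steps \<beta> = step_mset a b c \<and> F = canonical_expr a b c \<and> expr_gen F = hd \<beta> \<and>
     distinct_adj \<beta> \<and> \<beta> \<noteq> [] \<and> last \<beta> = N1"
  using assms
proof (cases rule: canonical.cases)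
  case (1 t r s)
  then obtain t' where "t = Suc t'" by (cases t) auto
  with 1 show ?thesis
    by (intro exI[of _ "2*t-1"] exI[of _ "2*s"] exI[of _ "2*r"])
      (simp add: rpt_simps pairing_idx step_mset_def canonical_expr_def add_ac del: last.simps)
next
  case (2 s r t)
  then obtain s' where "s = Suc s'" by (cases s) auto
  with 2 show ?thesis
    by (intro exI[of _ "2*t"] exI[of _ "2*s-1"] exI[of _ "2*r"])
      (simp add: rpt_simps pairing_idx step_mset_def canonical_expr_def add_ac del: last.simps)
next
  case (3 r s t)
  then obtain r' where "r = Suc r'" by (cases r) auto
  with 3 show ?thesis
    by (intro exI[of _ "2*t"] exI[of _ "2*s"] exI[of _ "2*r-1"])
      (simp add: rpt_simps pairing_idx step_mset_def canonical_expr_def add_ac del: last.simps)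
next
  case (4 r s t)
  then show ?thesis
    by (intro exI[of _ "2*t"] exI[of _ "2*s"] exI[of _ "2*r"])
      (simp add: rpt_simps pairing_idx step_mset_def canonical_expr_def add_ac del: last.simps)
next
  case (5 r s t)
  then obtain r' where "r = Suc r'" by (cases r) auto
  with 5 show ?thesis
    by (intro exI[of _ "2*t"] exI[of _ "2*s+1"] exI[of _ "2*r-1"])
      (simp add: rpt_simps pairing_idx step_mset_def canonical_expr_def add_ac del: last.simps)
next
  case (6 r t s)
  then obtain r' where "r = Suc r'" by (cases r) auto
  with 6 show ?thesis
    by (intro exI[of _ "2*t+1"] exI[of _ "2*s"] exI[of _ "2*r-1"])
      (simp add: rpt_simps pairing_idx step_mset_def canonical_expr_def add_ac del: last.simps)
next
  case (7 t s r)
  then obtain t' where "t = Suc t'" by (cases t) auto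
  with 7 show ?thesis
    by (intro exI[of _ "2*t-1"] exI[of _ "2*s+1"] exI[of _ "2*r"])
      (simp add: rpt_simps pairing_idx step_mset_def canonical_expr_def add_ac del: last.simps)
next
  case (8 r s t)
  then obtain r' s' where "r = Suc r'" "s = Suc s'" by (cases r; cases s) auto
  with 8 show ?thesis
    by (intro exI[of _ "2*t+1"] exI[of _ "2*s-1"] exI[of _ "2*r-1"])
      (simp add: rpt_simps pairing_idx step_mset_def canonical_expr_def add_ac del: last.simps)
qed

lemma canonical_exists: "\<exists>\<beta> F. canonical \<beta> F \<and> steps \<beta> = step_mset a b c"
proof -
  define t s r where "t = a div 2" and "s = b div 2" and "r = c div 2"
  have abc: "a = (if even a then 2 * t else Suc (2 * t))" "b = (if even b then 2 * s else Suc (2 * s))"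
    "c = (if even c then 2 * r else Suc (2 * r))"
    by (auto simp: t_def s_def r_def)
  note sim = rpt_simps pairing_idx step_mset_def add_ac
  consider "even a" "even b" "even c" | "even a" "even b" "odd c" | "even a" "odd b" "even c"
    | "even a" "odd b" "odd c" | "odd a" "even b" "even c" | "odd a" "even b" "odd c"
    | "odd a" "odd b" "even c" | "odd a" "odd b" "odd c" by blast
  then show ?thesis
  proof cases
    case 1
    with abc have EQ: "a = 2 * t" "b = 2 * s" "c = 2 * r" by simp_all
    show ?thesis unfolding EQ by (intro exI conjI, rule canonical.intros(4)[of r s t]) (simp_all add: sim)
  next
    case 2
    with abc have EQ: "a = 2 * t" "b = 2 * s" "c = Suc (2 * r)" by simp_all
    show ?thesis unfolding EQ by (intro exI conjI, rule canonical.intros(3)[of "Suc r" s t]) (simp_all add: sim)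
  next
    case 3
    with abc have EQ: "a = 2 * t" "b = Suc (2 * s)" "c = 2 * r" by simp_all
    show ?thesis unfolding EQ by (intro exI conjI, rule canonical.intros(2)[of "Suc s" r t]) (simp_all add: sim)
  next
    case 4
    with abc have EQ: "a = 2 * t" "b = Suc (2 * s)" "c = Suc (2 * r)" by simp_all
    show ?thesis unfolding EQ by (intro exI conjI, rule canonical.intros(5)[of "Suc r" s t]) (simp_all add: sim)
  next
    case 5
    with abc have EQ: "a = Suc (2 * t)" "b = 2 * s" "c = 2 * r" by simp_all
    show ?thesis unfolding EQ by (intro exI conjI, rule canonical.intros(1)[of "Suc t" r s]) (simp_all add: sim)
  next
    case 6
    with abc have EQ: "a = Suc (2 * t)" "b = 2 * s" "c = Suc (2 * r)" by simp_all
    show ?thesis unfolding EQ by (intro exI conjI, rule canonical.intros(6)[of "Suc r" t s]) (simp_all add: sim)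
  next
    case 7
    with abc have EQ: "a = Suc (2 * t)" "b = Suc (2 * s)" "c = 2 * r" by simp_all
    show ?thesis unfolding EQ by (intro exI conjI, rule canonical.intros(7)[of "Suc t" s r]) (simp_all add: sim)
  next
    case 8
    with abc have EQ: "a = Suc (2 * t)" "b = Suc (2 * s)" "c = Suc (2 * r)" by simp_all
    show ?thesis unfolding EQ by (intro exI conjI, rule canonical.intros(8)[of "Suc r" "Suc s" t]) (simp_all add: sim)
  qed
qed

lemma steps_eq_step_mset:
  assumes "distinct_adj \<alpha>"
  shows "\<exists>a b c. steps \<alpha> = step_mset a b c"
proof -
  have "steps \<alpha> = step_mset (count (steps \<alpha>) (pairing N1 N2)) (count (steps \<alpha>) (pairing N1 N3))
      (count (steps \<alpha>) (pairing N1 N4))" (is "_ = ?M")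
  proof (rule multiset_eqI)
    fix P
    show "count (steps \<alpha>) P = count ?M P"
    proof (cases "P \<in> {pairing N1 N2, pairing N1 N3, pairing N1 N4}")
      case True
      then show ?thesis by (auto simp: count_step_mset)
    next
      case False
      then have "P \<notin># steps \<alpha>"
        using steps_pairing[OF _ assms, of P] pairing_cases[of N1 N2 N3 N4] by auto
      then show ?thesis using False by (simp add: step_mset_def not_in_iff)
    qed
  qed
  then show ?thesis by blast
qed

section \<open>The expression attached to a sequence\<close>

text \<open>Up to the order of the factors and of the upper indices, the expression is the one whose value is
  \<open>E\<^sub>i(M)\<close>.\<close>

definition describes :: "idx expr \<Rightarrow> idx \<Rightarrow> idx set set multiset \<Rightarrow> bool" where
  "describes G i M \<longleftrightarrow> (\<exists>fs. G = Expr i fs \<and>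
     (\<lambda>(p, q, m). ({p, q}, m)) ` set fs = {({p, q}, count M (pairing p q)) | p q. distinct [i, p, q]})"

lemma pairs_eq:
  fixes i :: idx
  assumes d: "distinct [i, p, q, r]" and sym: "\<And>x y. g x y = g y x"
  shows "{({x, y}, g x y) | x y. distinct [i, x, y]} = {({p, q}, g p q), ({q, r}, g q r), ({r, p}, g r p)}"
    (is "?L = ?R")
proof
  show "?R \<subseteq> ?L" using d by auto
  show "?L \<subseteq> ?R"
  proof
    fix z assume "z \<in> ?L"
    then obtain x y where z: "z = ({x, y}, g x y)" and xy: "distinct [i, x, y]" by blast
    have "x \<in> {i, p, q, r}" "y \<in> {i, p, q, r}" using UNIV_eq_distinct[OF d] by auto
    with xy show "z \<in> ?R"
      using sym[of q p] sym[of r q] sym[of p r] by (auto simp: z insert_commute)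
  qed
qed

lemma describesI:
  assumes "distinct [i, p, q, r]"
    and "(\<lambda>(p, q, m). ({p, q}, m)) ` set fs =
      {({p, q}, count M (pairing p q)), ({q, r}, count M (pairing q r)), ({r, p}, count M (pairing r p))}"
  shows "describes (Expr i fs) i M"
proof -
  have "count M (pairing x y) = count M (pairing y x)" for x y by (metis pairing_commute)
  from pairs_eq[OF assms(1), of "\<lambda>p q. count M (pairing p q)", OF this]
  show ?thesis using assms(2) unfolding describes_def by simp
qed

lemma describes_canonical_expr:
  "describes (canonical_expr a b c) (expr_gen (canonical_expr a b c)) (step_mset a b c)"
proof -
  note I = describesI[where M = "step_mset a b c", unfolded pairing_idx count_step_mset]
  show ?thesis
    unfolding canonical_expr_def
    by (simp add: I[of N1 N2 N3 N4] I[of N2 N1 N3 N4] I[of N3 N1 N2 N4] I[of N4 N1 N2 N3]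
        pairing_idx count_step_mset insert_commute)
qed

lemma pairing_map: "bij \<tau> \<Longrightarrow> pairing (\<tau> i) (\<tau> j) = image \<tau> ` pairing i j"
  using bij_image_Compl_eq[of \<tau> "{i, j}"] by (simp add: pairing_def)

lemma steps_map: "bij \<tau> \<Longrightarrow> steps (map \<tau> \<alpha>) = image_mset (image (image \<tau>)) (steps \<alpha>)"
  by (induction \<alpha> rule: induct_list012) (simp_all add: pairing_map)

lemma inj_image_image:
  assumes "bij \<tau>"
  shows "inj (image (image \<tau>))"
proof -
  have "inj (image \<tau>)" by (rule inj_on_image) (simp add: bij_is_inj[OF assms])
  then have "inj_on (image \<tau>) (\<Union>UNIV)" by simp
  then show ?thesis by (rule inj_on_image)
qed

lemma count_image_mset_inj: "inj f \<Longrightarrow> count (image_mset f M) (f x) = count M x"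
  by (induction M) (auto simp: inj_eq)

text \<open>A permutation of the indices permutes the pairings, so the description is equivariant. This reduces
  sequences with an arbitrary start to those starting at 1.\<close>

lemma describes_map:
  assumes "bij \<tau>" "describes G i M"
  shows "describes (map_expr \<tau> G) (\<tau> i) (image_mset (image (image \<tau>)) M)"
proof -
  obtain fs where G: "G = Expr i fs"
    and fs: "(\<lambda>(p, q, m). ({p, q}, m)) ` set fs = {({p, q}, count M (pairing p q)) | p q. distinct [i, p, q]}"
    using assms(2) by (auto simp: describes_def)
  define fs' where "fs' = map (map_prod \<tau> (map_prod \<tau> id)) fs"
  have G': "map_expr \<tau> G = Expr (\<tau> i) fs'" by (simp add: G fs'_def)
  have c: "count (image_mset (image (image \<tau>)) M) (pairing (\<tau> p) (\<tau> q)) = count M (pairing p q)" for p q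
    unfolding pairing_map[OF assms(1)] by (rule count_image_mset_inj[OF inj_image_image[OF assms(1)]])
  have "(\<lambda>(p, q, m). ({p, q}, m)) ` set fs' = map_prod (image \<tau>) id ` ((\<lambda>(p, q, m). ({p, q}, m)) ` set fs)"
    by (force simp: fs'_def image_image)
  also have "\<dots> = {({\<tau> p, \<tau> q}, count M (pairing p q)) | p q. distinct [i, p, q]}"
    unfolding fs by force
  also have "\<dots> = {({p, q}, count (image_mset (image (image \<tau>)) M) (pairing p q)) | p q. distinct [\<tau> i, p, q]}"
    (is "?L = ?R")
  proof
    show "?L \<subseteq> ?R"
    proof
      fix z assume "z \<in> ?L"
      then obtain p q where "z = ({\<tau> p, \<tau> q}, count M (pairing p q))" "distinct [i, p, q]" by blast
      moreover from this have "distinct [\<tau> i, \<tau> p, \<tau> q]"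
        using bij_is_inj[OF assms(1)] by (simp add: inj_eq)
      ultimately show "z \<in> ?R" unfolding c[symmetric] by blast
    qed
    show "?R \<subseteq> ?L"
    proof
      fix z assume "z \<in> ?R"
      then obtain p q where z: "z = ({p, q}, count (image_mset (image (image \<tau>)) M) (pairing p q))"
        and d: "distinct [\<tau> i, p, q]" by blast
      obtain p' q' where pq: "p = \<tau> p'" "q = \<tau> q'" using bij_is_surj[OF assms(1)] by (metis surj_def)
      have "distinct [i, p', q']" using d by (auto simp: pq)
      then show "z \<in> ?L" unfolding z pq c by blast
    qed
  qed
  finally show ?thesis using G' by (auto simp: describes_def)
qed

lemma canonical_describes:
  assumes "canonical \<beta> F"
  shows "describes F (hd \<beta>) (steps \<beta>)"
proof -
  obtain a b c where "steps \<beta> = step_mset a b c" "F = canonical_expr a b c" "expr_gen F = hd \<beta>"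
    using canonical_data[OF assms] by blast
  then show ?thesis using describes_canonical_expr[of a b c] by simp
qed

lemma canonical_unique:
  assumes "canonical \<beta> F" "canonical \<beta>' F'" "steps \<beta> = steps \<beta>'"
  shows "F = F'"
proof -
  obtain a b c where 1: "steps \<beta> = step_mset a b c" "F = canonical_expr a b c"
    using canonical_data[OF assms(1)] by blast
  obtain a' b' c' where 2: "steps \<beta>' = step_mset a' b' c'" "F' = canonical_expr a' b' c'"
    using canonical_data[OF assms(2)] by blast
  have "a = a'" "b = b'" "c = c'" using 1(1) 2(1) assms(3) count_step_mset by metis+
  then show ?thesis using 1 2 by simp
qed

text \<open>Existence: the sequence moved to start at 1 has the same steps as some member of the eight families, hence is equivalent
  to it. Uniqueness: equivalent sequences have the same steps, and these determine the expression.\<close>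

lemma seq_expr_describes:
  assumes "admissible \<alpha>"
  shows "describes (seq_expr \<alpha>) (hd \<alpha>) (steps \<alpha>)"
proof -
  define \<tau> where "\<tau> = transpose N1 (last \<alpha>)"
  have \<tau>: "bij \<tau>" "inj \<tau>" "\<tau> (\<tau> x) = x" "\<tau> (last \<alpha>) = N1" for x
    by (simp_all add: \<tau>_def bij_is_inj)
  have map2: "map \<tau> (map \<tau> xs) = xs" for xs by (simp add: comp_def \<tau>(3))
  have \<alpha>: "\<alpha> \<noteq> []" "distinct_adj \<alpha>" using assms by (simp_all add: admissible_def)
  have m: "map \<tau> \<alpha> \<noteq> []" "distinct_adj (map \<tau> \<alpha>)" "last (map \<tau> \<alpha>) = N1"
    using \<alpha> \<tau>(2,4) by (simp_all add: distinct_adj_map_iff inj_on_subset last_map)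
  obtain \<beta> F where \<beta>: "canonical \<beta> F" "steps \<beta> = steps (map \<tau> \<alpha>)"
    using steps_eq_step_mset[OF m(2)] canonical_exists by metis
  then have "distinct_adj \<beta>" "\<beta> \<noteq> []" "last \<beta> = N1" using canonical_data[OF \<beta>(1)] by blast+
  then have "seq_equiv (map \<tau> \<alpha>) \<beta>"
    using m \<beta>(2) by (intro seq_equiv_if_steps_eq) simp_all
  from seq_equiv_map[OF \<tau>(2) this] have eqv: "seq_equiv \<alpha> (map \<tau> \<beta>)" unfolding map2 .
  have "seq_expr \<alpha> = map_expr \<tau> F"
    unfolding seq_expr_def \<tau>_def[symmetric]
  proof (rule the_equality)
    show "\<exists>\<beta> F'. canonical \<beta> F' \<and> seq_equiv \<alpha> (map \<tau> \<beta>) \<and> map_expr \<tau> F = map_expr \<tau> F'"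
      using \<beta>(1) eqv by blast
    fix G assume "\<exists>\<beta> F. canonical \<beta> F \<and> seq_equiv \<alpha> (map \<tau> \<beta>) \<and> G = map_expr \<tau> F"
    then obtain \<beta>' F' where \<beta>': "canonical \<beta>' F'" "seq_equiv \<alpha> (map \<tau> \<beta>')" "G = map_expr \<tau> F'" by blast
    have "steps (map \<tau> (map \<tau> \<beta>')) = steps (map \<tau> (map \<tau> \<beta>))"
      unfolding steps_map[OF \<tau>(1), of "map \<tau> \<beta>'"] steps_map[OF \<tau>(1), of "map \<tau> \<beta>"]
      using seq_equiv_steps[OF eqv] seq_equiv_steps[OF \<beta>'(2)] by simp
    then have "F' = F" using canonical_unique[OF \<beta>'(1) \<beta>(1)] unfolding map2 by blast
    then show "G = map_expr \<tau> F" using \<beta>'(3) by simp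
  qed
  moreover have "hd \<alpha> = \<tau> (hd \<beta>)"
    using seq_equiv_hd[OF eqv] \<open>\<beta> \<noteq> []\<close> by (simp add: hd_map)
  ultimately show ?thesis
    using describes_map[OF \<tau>(1) canonical_describes[OF \<beta>(1)]] seq_equiv_steps[OF eqv]
    by (simp add: steps_map[OF \<tau>(1)])
qed

lemma (in subgroup_rep) foldl_inf: "x \<in> \<rho> (foldl inf a bs) \<longleftrightarrow> x \<in> \<rho> a \<and> (\<forall>b\<in>set bs. x \<in> \<rho> b)"
  by (induction bs arbitrary: a) (auto simp: inf)

lemma (in subgroup_rep) describes_value:
  assumes "describes G i M"
  shows "\<rho> (expr_val G) = E i M"
proof -
  obtain fs where G: "G = Expr i fs"
    and fs: "(\<lambda>(p, q, m). ({p, q}, m)) ` set fs = {({p, q}, count M (pairing p q)) | p q. distinct [i, p, q]}"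
    using assms by (auto simp: describes_def)
  have val: "x \<in> \<rho> (expr_val G) \<longleftrightarrow> x \<in> X i \<and> (\<forall>(p, q, m)\<in>set fs. x \<in> A p q m)" for x
    by (auto simp: G foldl_inf)
  show ?thesis
  proof (intro set_eqI iffI)
    fix x assume "x \<in> \<rho> (expr_val G)"
    then have x: "x \<in> X i" "\<And>p q m. (p, q, m) \<in> set fs \<Longrightarrow> x \<in> A p q m" by (auto simp: val)
    have "x \<in> A p q (count M (pairing p q))" if d: "distinct [i, p, q]" for p q
    proof -
      have "({p, q}, count M (pairing p q)) \<in> (\<lambda>(p, q, m). ({p, q}, m)) ` set fs"
        unfolding fs using d by blast
      then obtain p' q' where "(p', q', count M (pairing p q)) \<in> set fs" "{p, q} = {p', q'}" by auto
      then have "x \<in> A p q (count M (pairing p q)) \<or> x \<in> A q p (count M (pairing p q))"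
        using x(2) by (auto simp: doubleton_eq_iff)
      then show ?thesis using atomic_flip[of i q p x] d x(1) by auto
    qed
    then show "x \<in> E i M" using x(1) by (simp add: E_def)
  next
    fix x assume x: "x \<in> E i M"
    have "x \<in> A p q m" if "(p, q, m) \<in> set fs" for p q m
    proof -
      have "({p, q}, m) \<in> {({p, q}, count M (pairing p q)) | p q. distinct [i, p, q]}"
        unfolding fs[symmetric] using that by force
      then obtain p' q' where "{p, q} = {p', q'}" "m = count M (pairing p' q')" "distinct [i, p', q']" by auto
      then have "m = count M (pairing p q)" "distinct [i, p, q]"
        by (auto simp: doubleton_eq_iff pairing_commute)
      then show ?thesis using x by (simp add: E_def)
    qed
    then show "x \<in> \<rho> (expr_val G)" using E_gen[OF x] by (auto simp: val)
  qed
qed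

lemma graph_of_three_eq:
  assumes "x \<noteq> y" "x \<noteq> z" "y \<noteq> z"
  shows "{(x, t), (y, s), (z, r)} = {(x, t'), (y, s'), (z, r')} \<longleftrightarrow> t' = t \<and> s' = s \<and> r' = r"
    (is "?L = ?R \<longleftrightarrow> _")
proof
  assume eq: "?L = ?R"
  have "(x, t) \<in> ?R" "(y, s) \<in> ?R" "(z, r) \<in> ?R" unfolding eq[symmetric] by simp_all
  then show "t' = t \<and> s' = s \<and> r' = r" using assms by simp
qed simp

lemma labelling_iff:
  assumes "describes G i M"
  shows "is_labelling G h j k l t s r \<longleftrightarrow> h = i \<and> distinct [i, j, k, l] \<and>
    t = count M (pairing j k) \<and> s = count M (pairing k l) \<and> r = count M (pairing l j)"
proof -
  obtain fs where G: "G = Expr i fs"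
    and fs: "(\<lambda>(p, q, m). ({p, q}, m)) ` set fs = {({p, q}, count M (pairing p q)) | p q. distinct [i, p, q]}"
    using assms by (auto simp: describes_def)
  have "is_labelling G h j k l t s r \<longleftrightarrow> h = i \<and>
      t = count M (pairing j k) \<and> s = count M (pairing k l) \<and> r = count M (pairing l j)"
    if d: "distinct [i, j, k, l]"
  proof -
    have "{j, k} \<noteq> {k, l}" "{j, k} \<noteq> {l, j}" "{k, l} \<noteq> {l, j}"
      using d by (auto simp: doubleton_eq_iff)
    note eq = graph_of_three_eq[OF this]
    have "(\<lambda>(p, q, m). ({p, q}, m)) ` set fs =
      {({j, k}, count M (pairing j k)), ({k, l}, count M (pairing k l)), ({l, j}, count M (pairing l j))}"
      unfolding fs using pairing_commute by (intro pairs_eq d) metis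
    then show ?thesis using d unfolding G is_labelling.simps by (simp only: eq) blast
  qed
  moreover have "is_labelling G h j k l t s r \<Longrightarrow> h = i \<and> distinct [i, j, k, l]"
    unfolding G is_labelling.simps by blast
  ultimately show ?thesis by blast
qed

section \<open>Equality in every representation\<close>

lemma e_elt_eq_e_tilde:
  fixes \<rho> :: "d4 \<Rightarrow> (idx list \<Rightarrow> 'v::ab_group_add) set"
  assumes "subgroup_rep \<rho>" "admissible \<alpha>"
  shows "\<rho> (e_elt \<alpha>) = \<rho> (e_tilde \<alpha>)"
proof -
  interpret subgroup_rep \<rho> by fact
  have \<alpha>: "\<alpha> \<noteq> []" "distinct_adj \<alpha>" using assms(2) by (simp_all add: admissible_def)
  show ?thesis
    unfolding e_elt_def describes_value[OF seq_expr_describes[OF assms(2)]]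
    using e_tilde_subset_E[OF \<alpha>] E_subset_e_tilde[OF assms(1) \<alpha>] by blast
qed

lemma f0_elt_eq_f0_tilde:
  fixes \<rho> :: "d4 \<Rightarrow> (idx list \<Rightarrow> 'v::ab_group_add) set"
  assumes "subgroup_rep \<rho>" "admissible \<alpha>"
  shows "\<rho> (f0_elt \<alpha>) = \<rho> (f0_tilde \<alpha>)"
proof -
  interpret subgroup_rep \<rho> by fact
  have \<alpha>: "\<alpha> \<noteq> []" "distinct_adj \<alpha>" using assms(2) by (simp_all add: admissible_def)
  show ?thesis
  proof (cases "length \<alpha> = 1")
    case True
    then obtain i where i: "\<alpha> = [i]" by (auto simp: length_Suc_conv)
    have "Gamma_f [i] = (\<lambda>k. [k]) ` (- {i})" by (auto simp: Gamma_f_single)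
    then have "e_tilde ` Gamma_f [i] = gen ` (- {i})"
      by (simp add: image_image e_tilde.simps[of "[_]"])
    then show ?thesis by (simp add: f0_elt_def f0_tilde_def i)
  next
    case False
    then have len: "length \<alpha> \<ge> 2" using \<alpha>(1) by (cases \<alpha>; cases "tl \<alpha>") auto
    define i M where "i = hd \<alpha>" and "M = steps \<alpha>"
    note lab = labelling_iff[OF seq_expr_describes[OF assms(2)], folded i_def M_def]
    define Q where "Q = (\<lambda>x. \<exists>h j k l t s r. is_labelling (seq_expr \<alpha>) h j k l t s r \<and> r \<ge> 1 \<and>
      x = inf (e_elt \<alpha>) (sup (inf (gen h) (atomic j k (t + 1))) (inf (atomic k l (s + 1)) (atomic l j (r - 1)))))"
    have "Q (f0_elt \<alpha>)"
    proof -
      have "steps \<alpha> \<noteq> {#}" using len by (cases \<alpha> rule: steps.cases) auto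
      then obtain P where P: "P \<in># M" by (auto simp: M_def)
      then obtain p q where pq: "p \<noteq> q" "P = pairing p q" using steps_pairing \<alpha>(2) unfolding M_def by blast
      obtain a b c where abc: "distinct [i, a, b, c]"
        using ex_distinct34 ex_distinct4 UNIV_idx ex_new_idx by (metis distinct_length_2_or_more distinct_singleton)
      have "\<exists>k. i \<noteq> k \<and> P = pairing i k"
        using pairing_cases[OF abc pq(1)] abc pq(2) by auto
      then obtain k where k: "i \<noteq> k" "P = pairing i k" by blast
      obtain l j where "distinct [i, k, l, j]" using ex_distinct34[OF k(1)] .
      then have d: "distinct [i, j, k, l]" and "P = pairing l j"
        unfolding k(2) by (auto intro!: pairing_complement)
      then have "\<exists>x. Q x"
        using P unfolding Q_def lab by (auto simp: Suc_le_eq)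
      then show ?thesis
        using False someI_ex[of Q] by (simp add: f0_elt_def Q_def)
    qed
    then obtain j k l where d: "distinct [i, j, k, l]" and r: "count M (pairing l j) \<ge> 1"
      and f0: "f0_elt \<alpha> = inf (e_elt \<alpha>) (sup (inf (gen i) (atomic j k (count M (pairing j k) + 1)))
        (inf (atomic k l (count M (pairing k l) + 1)) (atomic l j (count M (pairing l j) - 1))))"
      unfolding Q_def lab by blast
    obtain M' where M': "M = add_mset (pairing l j) M'"
      using r multi_member_split[of "pairing l j" M] by (auto simp: Suc_le_eq)
    have "all_pairings (pairing i k) (pairing i j) (pairing i l)" using d by (intro all_pairingsI) auto
    moreover have "pairing i k = pairing l j" "pairing i j = pairing k l" "pairing i l = pairing j k"
      using d by (auto intro!: pairing_complement)
    ultimately have all: "all_pairings (pairing l j) (pairing k l) (pairing j k)" by simp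
    have "\<rho> (e_elt \<alpha>) = E i M"
      unfolding e_elt_def i_def M_def by (rule describes_value[OF seq_expr_describes[OF assms(2)]])
    then have val: "\<rho> (f0_elt \<alpha>) = E i M \<inter> \<rho> (sup (inf (gen i) (atomic j k (count M (pairing j k) + 1)))
        (inf (atomic k l (count M (pairing k l) + 1)) (atomic l j (count M (pairing l j) - 1))))"
      by (simp only: f0 inf)
    show ?thesis
    proof
      show "\<rho> (f0_tilde \<alpha>) \<subseteq> \<rho> (f0_elt \<alpha>)"
        unfolding val using f0_tilde_subset[OF \<alpha>] d r unfolding i_def M_def by blast
      have "\<rho> (f0_elt \<alpha>) \<subseteq> F i M' (pairing l j) (pairing k l) (pairing j k)"
        unfolding val by (rule f_formula_subset_F[OF d M'])
      also have "\<dots> \<subseteq> \<rho> (f0_tilde \<alpha>)"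
        unfolding i_def using M' M_def by (intro F_subset_f0_tilde[OF assms(1) len \<alpha>(2) all]) simp
      finally show "\<rho> (f0_elt \<alpha>) \<subseteq> \<rho> (f0_tilde \<alpha>)" .
    qed
  qed
qed

text \<open>Moves a representation in an arbitrary space to the type on which reflection is defined.\<close>

definition embed :: "'v::zero \<Rightarrow> idx list \<Rightarrow> 'v" where
  "embed v = (\<lambda>xs. if xs = [] then v else 0)"

lemma inj_embed: "inj embed"
proof (rule injI)
  fix u v :: 'a assume "embed u = embed v"
  then have "embed u [] = embed v []" by simp
  then show "u = v" by (simp add: embed_def)
qed

lemma embed_add: "embed (u + v) = embed u + (embed v :: idx list \<Rightarrow> 'v::ab_group_add)"
  and embed_diff: "embed (u - v) = embed u - (embed v :: idx list \<Rightarrow> 'v::ab_group_add)"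
  and embed_zero: "embed 0 = (0 :: idx list \<Rightarrow> 'v::ab_group_add)"
  by (auto simp: embed_def fun_eq_iff)

lemma subgroup_rep_embed:
  fixes scale :: "'k::field \<Rightarrow> 'v::ab_group_add \<Rightarrow> 'v"
  assumes "d4_representation scale V \<rho>"
  shows "subgroup_rep (\<lambda>x. embed ` \<rho> x)"
proof
  interpret vector_space scale using assms by (simp add: d4_representation_def)
  have sub: "subspace (\<rho> a)" for a using assms by (simp add: d4_representation_def)
  show "add_subgroup (embed ` \<rho> a)" for a
    unfolding add_subgroup_def
  proof (intro conjI ballI)
    show "0 \<in> embed ` \<rho> a" using subspace_0[OF sub[of a]] embed_zero by force
    fix x y assume "x \<in> embed ` \<rho> a" "y \<in> embed ` \<rho> a"
    then obtain u v where "u \<in> \<rho> a" "v \<in> \<rho> a" "x = embed u" "y = embed v" by blast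
    then show "x - y \<in> embed ` \<rho> a"
      using subspace_diff[OF sub[of a], of u v] by (auto simp flip: embed_diff)
  qed
  show "embed ` \<rho> (sup a b) = {u + v | u v. u \<in> embed ` \<rho> a \<and> v \<in> embed ` \<rho> b}" for a b
  proof -
    have "\<rho> (sup a b) = {u + v | u v. u \<in> \<rho> a \<and> v \<in> \<rho> b}"
      using assms by (simp add: d4_representation_def)
    then have "embed ` \<rho> (sup a b) = {embed (u + v) | u v. u \<in> \<rho> a \<and> v \<in> \<rho> b}" by auto
    then show ?thesis unfolding embed_add by blast
  qed
  show "embed ` \<rho> (inf a b) = embed ` \<rho> a \<inter> embed ` \<rho> b" for a b
    using assms by (simp add: d4_representation_def image_Int[OF inj_embed])
qed

theorem proposition2p3:
  fixes \<alpha> :: "idx list"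
  assumes "admissible \<alpha>"
  shows "theta TYPE('k::field) TYPE('v::ab_group_add) (e_elt \<alpha>) (e_tilde \<alpha>) \<and>
         theta TYPE('k) TYPE('v) (f0_elt \<alpha>) (f0_tilde \<alpha>)"
proof -
  have "\<rho> (e_elt \<alpha>) = \<rho> (e_tilde \<alpha>) \<and> \<rho> (f0_elt \<alpha>) = \<rho> (f0_tilde \<alpha>)"
    if "d4_representation scale V \<rho>" for scale :: "'k \<Rightarrow> 'v \<Rightarrow> 'v" and V \<rho>
  proof -
    note rep = subgroup_rep_embed[OF that]
    show ?thesis
      using e_elt_eq_e_tilde[OF rep assms] f0_elt_eq_f0_tilde[OF rep assms]
      by (simp add: inj_image_eq_iff[OF inj_embed])
  qed
  then show ?thesis unfolding theta_def by blast
qed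

end
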